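(* Let $n\ge3$ and let $w=(w_1,\dots,w_n)$ be distributed according to the stationary distribution of the multispecies TASEP on a ring with $n$ sites of type $(1,1,\dots,1)$. For $1\le i<j<k\le n$, $$\mathbb P(w_1=k,\ w_2=j,\ w_3=i)=\frac{6(j-i)(k-i)(k-j)}{n^3(n-1)^2(n-2)}.$$
   Context: Multispecies TASEP on a ring with $n$ sites of type $(1,\dots,1)$: the states are the permutations $w=(w_1,\dots,w_n)$ of $\{1,\dots,n\}$, with positions taken cyclically modulo $n$ ($w_i$ is the species of the particle at site $i$). It is the continuous-time Markov chain in which every particle carries an independent rate-$1$ exponential clock; when the clock of the particle of species $j$ rings, it exchanges positions with the particle of species $k$ immediately to its left if $k>j$, and nothing happens otherwise. It has a unique stationary distribution. *)

theory Defs
  imports "HOL-Probability.Probability" "HOL-Combinatorics.Permutations"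
begin

definition tasep_states :: "nat \<Rightarrow> (nat \<Rightarrow> nat) set" where
  "tasep_states n = {w. w permutes {1..n}}"

definition left_site :: "nat \<Rightarrow> nat \<Rightarrow> nat" where
  "left_site n s = (if s = 1 then n else s - 1)"

text \<open>The value \<open>w s\<close> is the species at site \<open>s\<close>, so the particle of species \<open>j\<close> sits at
  site \<open>inv w j\<close>. The following is the configuration right after the clock of that
  particle rings.\<close>

definition tasep_jump :: "nat \<Rightarrow> nat \<Rightarrow> (nat \<Rightarrow> nat) \<Rightarrow> (nat \<Rightarrow> nat)" where
  "tasep_jump n j w =
     (let s = inv w j; l = left_site n s
      in if w l > j then w \<circ> Transposition.transpose l s else w)"

text \<open>Each of the \<open>n\<close> clocks has rate 1, so the infinitesimal generator is the sum over \<open>j\<close>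
  of (transition matrix of the jump of \<open>j\<close>) minus the identity; rings that change
  nothing cancel.\<close>

definition tasep_generator :: "nat \<Rightarrow> (nat \<Rightarrow> nat) \<Rightarrow> (nat \<Rightarrow> nat) \<Rightarrow> real" where
  "tasep_generator n w v =
     (\<Sum>j\<in>{1..n}. of_bool (tasep_jump n j w = v) - of_bool (w = v))"

primrec tasep_generator_power ::
  "nat \<Rightarrow> nat \<Rightarrow> (nat \<Rightarrow> nat) \<Rightarrow> (nat \<Rightarrow> nat) \<Rightarrow> real" where
  "tasep_generator_power n 0 w v = of_bool (w = v)"
| "tasep_generator_power n (Suc m) w v =
     (\<Sum>u\<in>tasep_states n. tasep_generator n w u * tasep_generator_power n m u v)"

text \<open>The probability of being in \<open>v\<close> at time \<open>t\<close> when started from \<open>w\<close>: the \<open>(w, v)\<close> entry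
  of the exponential of \<open>t\<close> times the generator.\<close>

definition tasep_transition :: "nat \<Rightarrow> real \<Rightarrow> (nat \<Rightarrow> nat) \<Rightarrow> (nat \<Rightarrow> nat) \<Rightarrow> real" where
  "tasep_transition n t w v = (\<Sum>m. t ^ m / fact m * tasep_generator_power n m w v)"

definition tasep_stationary :: "nat \<Rightarrow> (nat \<Rightarrow> nat) pmf \<Rightarrow> bool" where
  "tasep_stationary n p \<longleftrightarrow>
     set_pmf p \<subseteq> tasep_states n \<and>
     (\<forall>t\<ge>0. \<forall>v\<in>tasep_states n.
        (\<Sum>w\<in>tasep_states n. pmf p w * tasep_transition n t w v) = pmf p v)"

end

theory Submission
  imports Defs
begin

text \<open>For \<open>a \<le> b \<le> c\<close> let \<open>G(a, b, c)\<close> be the probability of \<open>w 1 > c\<close>, \<open>b < w 2 \<le> c\<close>, \<open>w 3 \<le> a\<close>; the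
  claimed probability is a mixed difference of \<open>G\<close>. It only involves the three nested sets of
  sites with species at most \<open>a\<close>, \<open>b\<close>, \<open>c\<close>, whose joint law is that of a Ferrari-Martin multiline
  queue: rows \<open>A\<close>, \<open>B\<close>, \<open>C\<close> of sizes \<open>a\<close>, \<open>b\<close>, \<open>c\<close> are chosen uniformly and each row serves the
  departures of the rows above it. In these terms the event says that \<open>C\<close> and \<open>B\<close> look like \<open>011\<close>
  and \<open>001\<close> on the first three sites, that \<open>C\<close> dominates \<open>B\<close> on the remaining ones, and that it is
  not the case that \<open>A\<close> looks like \<open>000\<close> and is dominated by \<open>B\<close>. Chains of dominated sets are
  counted by a determinant of binomial coefficients (they are semistandard tableaux with three
  columns), so \<open>G\<close> is an explicit rational function.\<close>

section \<open>Stationarity in terms of the generator\<close>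

text \<open>Only the threshold sets \<open>{s. w s \<le> m}\<close> matter. A bell at a site acts on
  all of them by the same left jump, whatever the species, so their joint law is invariant for an
  autonomous chain on lists of sets, and uniqueness is needed for that chain alone. Its lists need
  not be nested: arbitrary sets of the right sizes are easier to describe, and every such list can
  still be driven to the initial segments, which is enough for uniqueness. Invariance of the queue
  law is not checked state by state. It is an induction on rows: adding a uniform row of services
  preserves invariance, because a bell either commutes with the queue or can be traded for one that
  the queue does not notice.\<close>

lemma finite_tasep_states: "finite (tasep_states n)"
  unfolding tasep_states_def by (rule finite_permutations) simp

lemma tasep_generator_bound: "\<bar>tasep_generator n w v\<bar> \<le> real n"
proof -
  have "\<bar>tasep_generator n w v\<bar> \<le> (\<Sum>j\<in>{1..n}. 1)"
    unfolding tasep_generator_def by (rule order_trans[OF sum_abs sum_mono]) auto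
  then show ?thesis by simp
qed

lemma tasep_generator_power_bound:
  "\<bar>tasep_generator_power n m w v\<bar> \<le> (real n * card (tasep_states n)) ^ m"
proof (induction m arbitrary: w)
  case (Suc m)
  have "\<bar>tasep_generator_power n (Suc m) w v\<bar>
      \<le> (\<Sum>u\<in>tasep_states n. \<bar>tasep_generator n w u\<bar> * \<bar>tasep_generator_power n m u v\<bar>)"
    by (simp add: abs_mult[symmetric] sum_abs)
  also have "\<dots> \<le> (\<Sum>u\<in>tasep_states n. real n * (real n * card (tasep_states n)) ^ m)"
    by (intro sum_mono mult_mono tasep_generator_bound Suc) auto
  finally show ?case by (simp add: algebra_simps)
qed auto

text \<open>Stationarity is assumed for \<open>t \<ge> 0\<close> only, so the derivative at 0 has to
  be read off from the right.\<close>

lemma DERIV_const_right_imp_zero: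
  fixes f :: "real \<Rightarrow> real"
  assumes "DERIV f 0 :> D" and const: "\<And>t. t \<ge> 0 \<Longrightarrow> f t = C"
  shows "D = 0"
proof -
  have "((\<lambda>h. (f (0 + h) - f 0) / h) \<longlongrightarrow> D) (at 0)"
    using assms(1) by (simp add: DERIV_def)
  then have "((\<lambda>h. (f (0 + h) - f 0) / h) \<longlongrightarrow> D) (at_right 0)"
    by (rule tendsto_mono[rotated]) (simp add: at_le)
  moreover have "eventually (\<lambda>h. (f (0 + h) - f 0) / h = 0) (at_right 0)"
    using const by (simp add: eventually_at_right_field) (meson less_imp_le zero_less_one)
  ultimately have "((\<lambda>h. 0) \<longlongrightarrow> D) (at_right (0::real))"
    by (rule Lim_transform_eventually)
  then show ?thesis
    using tendsto_unique[of "at_right (0::real)" "\<lambda>h. 0" D 0] by simp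
qed

text \<open>In \<open>t\<close>, the left side of the stationarity equation is an everywhere
  convergent power series whose linear coefficient is the sum in question; being constant for
  \<open>t \<ge> 0\<close>, it has derivative 0 at 0.\<close>

lemma stationary_generator:
  assumes st: "tasep_stationary n p" and v: "v \<in> tasep_states n"
  shows "(\<Sum>w\<in>tasep_states n. pmf p w * tasep_generator n w v) = 0"
proof -
  define B where "B = real n * card (tasep_states n)"
  define c where "c m = (\<Sum>w\<in>tasep_states n. pmf p w * (tasep_generator_power n m w v / fact m))" for m
  have summ: "summable (\<lambda>m. t ^ m / fact m * tasep_generator_power n m w v)" for w and t :: real
  proof (rule summable_comparison_test[OF _ summable_exp[of "\<bar>t\<bar> * B"]], intro exI allI impI)
    fix m
    have "\<bar>t\<bar> ^ m * \<bar>tasep_generator_power n m w v\<bar> \<le> \<bar>t\<bar> ^ m * B ^ m"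
      using tasep_generator_power_bound unfolding B_def by (intro mult_left_mono) auto
    then show "norm (t ^ m / fact m * tasep_generator_power n m w v)
        \<le> inverse (fact m) * (\<bar>t\<bar> * B) ^ m"
      by (simp add: abs_mult power_abs power_mult_distrib field_simps)
  qed
  have sums: "(\<lambda>m. c m * t ^ m) sums (\<Sum>w\<in>tasep_states n. pmf p w * tasep_transition n t w v)" for t
  proof -
    have "(\<lambda>m. \<Sum>w\<in>tasep_states n. pmf p w * (t ^ m / fact m * tasep_generator_power n m w v))
      sums (\<Sum>w\<in>tasep_states n. pmf p w * tasep_transition n t w v)"
      unfolding tasep_transition_def
      by (intro sums_sum sums_mult summable_sums summ)
    then show ?thesis by (simp add: c_def sum_distrib_left sum_distrib_right algebra_simps)
  qed
  have "DERIV (\<lambda>t. \<Sum>m. c m * t ^ m) 0 :> (\<Sum>m. diffs c m * 0 ^ m)"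
    using sums sums_summable by (intro termdiffs_strong_converges_everywhere) blast
  moreover have "(\<Sum>m. c m * t ^ m) = pmf p v" if "t \<ge> 0" for t
    using st v that sums[of t] unfolding tasep_stationary_def by (simp add: sums_iff)
  ultimately have "(\<Sum>m. diffs c m * 0 ^ m) = 0"
    by (rule DERIV_const_right_imp_zero)
  then have "c 1 = 0" by (simp only: powser_zero) (simp add: diffs_def)
  moreover have "tasep_generator_power n 1 w v = tasep_generator n w v" for w
    using v finite_tasep_states by (simp add: of_bool_def if_distrib cong: if_cong)
  ultimately show ?thesis by (simp add: c_def)
qed

text \<open>Clocks are attached to sites here: the bell at \<open>s\<close> is the clock of whichever particle sits
  at \<open>s\<close>. Summed over all clocks, the two labellings give the same generator.\<close>

definition bell :: "nat \<Rightarrow> nat \<Rightarrow> (nat \<Rightarrow> nat) \<Rightarrow> (nat \<Rightarrow> nat)" where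
  "bell n s w = (if w (left_site n s) > w s then w \<circ> Transposition.transpose (left_site n s) s else w)"

lemma left_site_in: "s \<in> {1..n} \<Longrightarrow> left_site n s \<in> {1..n}"
  by (auto simp: left_site_def)

lemma bell_in_states: "w \<in> tasep_states n \<Longrightarrow> s \<in> {1..n} \<Longrightarrow> bell n s w \<in> tasep_states n"
  unfolding bell_def tasep_states_def using left_site_in[of s n]
  by (auto intro!: permutes_compose permutes_swap_id)

text \<open>The balance equations integrated against a test function. Relabelling the clocks by
  \<open>j = w s\<close> passes from species to sites.\<close>

lemma stationary_bell:
  assumes st: "tasep_stationary n p"
  shows "(\<Sum>w\<in>tasep_states n. pmf p w * (\<Sum>s\<in>{1..n}. f (bell n s w)))
    = real n * (\<Sum>w\<in>tasep_states n. pmf p w * f w)"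
proof -
  let ?S = "tasep_states n"
  have gen: "(\<Sum>v\<in>?S. tasep_generator n w v * f v) = (\<Sum>s\<in>{1..n}. f (bell n s w)) - real n * f w"
    if w: "w \<in> ?S" for w
  proof -
    have perm: "w permutes {1..n}" using w by (simp add: tasep_states_def)
    have inw: "inv w (w s) = s" for s using perm by (simp add: permutes_inverses)
    have jump: "tasep_jump n (w s) w = bell n s w" for s
      by (simp add: tasep_jump_def bell_def inw Let_def)
    have "(\<Sum>v\<in>?S. tasep_generator n w v * f v)
      = (\<Sum>v\<in>?S. \<Sum>j\<in>{1..n}. (of_bool (tasep_jump n j w = v) - of_bool (w = v)) * f v)"
      by (simp add: tasep_generator_def sum_distrib_right)
    also have "\<dots> = (\<Sum>j\<in>{1..n}. \<Sum>v\<in>?S. (of_bool (tasep_jump n j w = v) - of_bool (w = v)) * f v)"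
      by (rule sum.swap)
    also have "\<dots> = (\<Sum>s\<in>{1..n}. \<Sum>v\<in>?S. (of_bool (tasep_jump n (w s) w = v) - of_bool (w = v)) * f v)"
      using permutes_imp_bij[OF perm] by (rule sum.reindex_bij_betw[symmetric])
    also have "\<dots> = (\<Sum>s\<in>{1..n}. f (bell n s w) - f w)"
    proof (rule sum.cong[OF refl])
      fix s assume "s \<in> {1..n}"
      then have "bell n s w \<in> ?S" using bell_in_states w by blast
      then show "(\<Sum>v\<in>?S. (of_bool (tasep_jump n (w s) w = v) - of_bool (w = v)) * f v)
        = f (bell n s w) - f w"
        using w finite_tasep_states
        by (simp add: jump left_diff_distrib sum_subtractf of_bool_def if_distrib[of "\<lambda>x. x * _"] cong: if_cong)
    qed
    finally show ?thesis by (simp add: sum_subtractf)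
  qed
  have "0 = (\<Sum>v\<in>?S. (\<Sum>w\<in>?S. pmf p w * tasep_generator n w v) * f v)"
    by (simp add: stationary_generator[OF st])
  also have "\<dots> = (\<Sum>w\<in>?S. pmf p w * (\<Sum>v\<in>?S. tasep_generator n w v * f v))"
    unfolding sum_distrib_left sum_distrib_right mult.assoc by (rule sum.swap)
  also have "\<dots> = (\<Sum>w\<in>?S. pmf p w * ((\<Sum>s\<in>{1..n}. f (bell n s w)) - real n * f w))"
    by (simp add: gen)
  finally show ?thesis
    by (simp add: algebra_simps sum_subtractf sum_distrib_left)
qed

section \<open>Uniqueness of the stationary law of lists of particle sets\<close>

definition jump_left :: "nat \<Rightarrow> nat \<Rightarrow> nat set \<Rightarrow> nat set" where
  "jump_left n s S =
     (if s \<in> S \<and> left_site n s \<notin> S then insert (left_site n s) (S - {s}) else S)"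

text \<open>If \<open>d\<close> is invariant then so is \<open>\<bar>d\<bar>\<close>, hence so are the positive and negative parts. One of them
  vanishes at \<open>v0\<close>, and an invariant nonnegative weight that vanishes at a state vanishes wherever
  that state can be reached from.\<close>

lemma signed_stationary_zero:
  fixes d :: "'a \<Rightarrow> real" and f :: "'i \<Rightarrow> 'a \<Rightarrow> 'a"
  assumes X: "finite X" and I: "finite I"
    and closed: "\<And>i x. i \<in> I \<Longrightarrow> x \<in> X \<Longrightarrow> f i x \<in> X"
    and st: "\<And>v. v \<in> X \<Longrightarrow> (\<Sum>i\<in>I. \<Sum>x\<in>{x\<in>X. f i x = v}. d x) = real (card I) * d v"
    and v0: "v0 \<in> X"
    and reach: "\<And>x. x \<in> X \<Longrightarrow> (\<lambda>x y. \<exists>i\<in>I. y = f i x)\<^sup>*\<^sup>* x v0"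
    and total: "sum d X = 0"
  shows "x \<in> X \<Longrightarrow> d x = 0"
proof -
  let ?T = "\<lambda>g v. (\<Sum>i\<in>I. \<Sum>x\<in>{x\<in>X. f i x = v}. g x) :: real"
  have mass: "(\<Sum>v\<in>X. ?T g v) = real (card I) * sum g X" for g :: "'a \<Rightarrow> real"
  proof -
    have "(\<Sum>v\<in>X. ?T g v) = (\<Sum>i\<in>I. \<Sum>v\<in>X. \<Sum>x\<in>{x\<in>X. f i x = v}. g x)"
      by (rule sum.swap)
    also have "\<dots> = (\<Sum>i\<in>I. sum g X)"
      by (intro sum.cong refl sum.group X) (use closed in auto)
    finally show ?thesis by simp
  qed
  have le: "real (card I) * \<bar>d v\<bar> \<le> ?T (\<lambda>x. \<bar>d x\<bar>) v" if "v \<in> X" for v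
  proof -
    have "real (card I) * \<bar>d v\<bar> = \<bar>?T d v\<bar>" using st[OF that] by (simp add: abs_mult)
    also have "\<dots> \<le> ?T (\<lambda>x. \<bar>d x\<bar>) v"
      by (rule order_trans[OF sum_abs]) (intro sum_mono sum_abs)
    finally show ?thesis .
  qed
  \<comment> \<open>The triangle inequality holds at every state and both sides have the same total,
    so it is an equality everywhere.\<close>
  have abs_st: "?T (\<lambda>x. \<bar>d x\<bar>) v = real (card I) * \<bar>d v\<bar>" if "v \<in> X" for v
  proof (rule ccontr)
    assume "\<not> ?thesis"
    then have "(\<Sum>v\<in>X. real (card I) * \<bar>d v\<bar>) < (\<Sum>v\<in>X. ?T (\<lambda>x. \<bar>d x\<bar>) v)"
      using le that X by (intro sum_strict_mono_ex1 bexI[of _ v]) (force simp: less_le)+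
    then show False using mass[of "\<lambda>x. \<bar>d x\<bar>"] by (simp add: sum_distrib_left)
  qed
  have zero: "g y = 0"
    if y: "y \<in> X" and nn: "\<And>x. g x \<ge> 0" and inv: "\<And>v. v \<in> X \<Longrightarrow> ?T g v = real (card I) * g v"
      and g0: "g v0 = 0" for g :: "'a \<Rightarrow> real" and y
    using reach[OF y] y
  proof (induction rule: converse_rtranclp_induct)
    case base then show ?case using g0 by simp
  next
    case (step x z)
    then obtain i where i: "i \<in> I" "z = f i x" by blast
    then have "z \<in> X" using closed step by blast
    then have "g z = 0" using step by blast
    then have "?T g z = 0" using inv[OF \<open>z \<in> X\<close>] by simp
    then have "(\<Sum>x\<in>{x\<in>X. f i x = z}. g x) = 0"
      using i I nn by (subst (asm) sum_nonneg_eq_0_iff) (auto intro: sum_nonneg)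
    then show ?case
      using i X nn step.prems by (subst (asm) sum_nonneg_eq_0_iff) auto
  qed
  define P where "P x = (\<bar>d x\<bar> + d x) / 2" for x
  define N where "N x = (\<bar>d x\<bar> - d x) / 2" for x
  have P: "P x \<ge> 0" "N x \<ge> 0" "P x - N x = d x" for x
    by (auto simp: P_def N_def field_simps)
  have TP: "?T P v = real (card I) * P v" if "v \<in> X" for v
    using abs_st[OF that] st[OF that]
    by (simp add: P_def sum_divide_distrib[symmetric] sum.distrib algebra_simps)
  have TN: "?T N v = real (card I) * N v" if "v \<in> X" for v
    using abs_st[OF that] st[OF that]
    by (simp add: N_def sum_divide_distrib[symmetric] sum_subtractf algebra_simps)
  have PN: "sum P X = sum N X" using total by (simp add: P(3)[symmetric] sum_subtractf)
  have "P v0 = 0 \<or> N v0 = 0" by (auto simp: P_def N_def)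
  then have "(\<forall>x\<in>X. P x = 0) \<or> (\<forall>x\<in>X. N x = 0)"
    using zero[of _ P] zero[of _ N] P TP TN by blast
  then have "(\<forall>x\<in>X. P x = 0) \<and> (\<forall>x\<in>X. N x = 0)"
    using PN sum_nonneg_eq_0_iff[OF X, of P] sum_nonneg_eq_0_iff[OF X, of N] P by auto
  then show "x \<in> X \<Longrightarrow> d x = 0" using P(3)[of x] by simp
qed

section \<open>Reaching the initial segments by left jumps\<close>

lemma jump_left_subset: "s \<in> {1..n} \<Longrightarrow> S \<subseteq> {1..n} \<Longrightarrow> jump_left n s S \<subseteq> {1..n}"
  by (auto simp: jump_left_def left_site_def)

lemma card_jump_left: "finite S \<Longrightarrow> card (jump_left n s S) = card S"
  by (auto simp: jump_left_def card_Suc_Diff1 simp del: card_Diff_insert card_Diff_singleton)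

text \<open>The sum of the sites is a potential for reachability. Site 1 is left out because its
  jump wraps around to \<open>n\<close>.\<close>

lemma sum_jump_left_le:
  assumes "finite S" "s \<in> {2..n}"
  shows "\<Sum>(jump_left n s S) \<le> \<Sum>S"
    and "s \<in> S \<Longrightarrow> s - 1 \<notin> S \<Longrightarrow> \<Sum>(jump_left n s S) < \<Sum>S"
proof -
  have "\<Sum>(insert (s - 1) (S - {s})) < \<Sum>S" if "s \<in> S" "s - 1 \<notin> S"
    using assms that sum.remove[of S s "\<lambda>x. x"] by simp
  then show "\<Sum>(jump_left n s S) \<le> \<Sum>S" "s \<in> S \<Longrightarrow> s - 1 \<notin> S \<Longrightarrow> \<Sum>(jump_left n s S) < \<Sum>S"
    using assms by (auto simp: jump_left_def left_site_def less_imp_le)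
qed

lemma down_closed_eq_initial:
  assumes S: "S \<subseteq> {1..n}" and dc: "\<And>s. s \<in> {2..n} \<Longrightarrow> s \<in> S \<Longrightarrow> s - 1 \<in> S"
  shows "S = {1..card S}"
proof (cases "S = {}")
  case False
  have fin: "finite S" using S finite_subset by blast
  have down: "m - k \<in> S" if "m \<in> S" "k < m" for m k
    using that
  proof (induction k)
    case (Suc k)
    then have "m - k \<in> S" "m - k \<in> {2..n}" using S by (auto simp: subset_eq)
    then have "m - k - 1 \<in> S" using dc by blast
    then show ?case by simp
  qed simp
  have "S = {1..Max S}"
  proof (intro equalityI subsetI)
    fix x assume "x \<in> {1..Max S}"
    then show "x \<in> S" using down[of "Max S" "Max S - x"] fin False by auto
  qed (use fin S in auto)
  then show ?thesis by (metis card_atLeastAtMost diff_Suc_1)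
qed auto

definition set_lists :: "nat \<Rightarrow> nat list \<Rightarrow> nat set list set" where
  "set_lists n ms = {L. set L \<subseteq> Pow {1..n} \<and> map card L = ms}"

lemma finite_set_lists: "finite (set_lists n ms)"
proof (rule finite_subset)
  show "set_lists n ms \<subseteq> {L. set L \<subseteq> Pow {1..n} \<and> length L = length ms}"
    by (auto simp: set_lists_def)
qed (simp add: finite_lists_length_eq)

lemma set_lists_jump_left:
  assumes "s \<in> {1..n}" "L \<in> set_lists n ms"
  shows "map (jump_left n s) L \<in> set_lists n ms"
proof -
  have "finite S" if "S \<in> set L" for S
    using that assms finite_subset[of S "{1..n}"] unfolding set_lists_def by auto
  then have "map card (map (jump_left n s) L) = map card L"
    by (simp add: card_jump_left)
  moreover have "set (map (jump_left n s) L) \<subseteq> Pow {1..n}"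
    using assms jump_left_subset[OF assms(1)] unfolding set_lists_def by auto
  ultimately show ?thesis
    using assms(2) unfolding set_lists_def mem_Collect_eq by (simp only: simp_thms)
qed

text \<open>Induction on the total of all sites in all sets. If some set has a particle at
  \<open>s \<ge> 2\<close> and a hole at \<open>s - 1\<close>, the bell at \<open>s\<close> lowers
  its sum and raises no other; a list without such a place consists of initial segments.\<close>

lemma set_lists_reach:
  assumes "L \<in> set_lists n ms"
  shows "(\<lambda>x y. \<exists>s\<in>{1..n}. y = map (jump_left n s) x)\<^sup>*\<^sup>* L (map (\<lambda>m. {1..m}) ms)"
  using assms
proof (induction "\<Sum>S\<leftarrow>L. \<Sum>S" arbitrary: L rule: less_induct)
  case less
  have sub: "S \<subseteq> {1..n}" "finite S" if "S \<in> set L" for S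
    using that less.prems finite_subset[of S "{1..n}"] unfolding set_lists_def by auto
  show ?case
  proof (cases "\<forall>S\<in>set L. \<forall>s\<in>{2..n}. s \<in> S \<longrightarrow> s - 1 \<in> S")
    case True
    then have "S = {1..card S}" if "S \<in> set L" for S
      using that sub by (intro down_closed_eq_initial) blast+
    then have "map (\<lambda>S. {1..card S}) L = L" by (intro map_idI) (rule sym)
    then have "L = map (\<lambda>S. {1..card S}) L" by (rule sym)
    also have "\<dots> = map (\<lambda>m. {1..m}) ms"
      using less.prems by (auto simp: set_lists_def)
    finally show ?thesis by simp
  next
    case False
    then obtain S s where S: "S \<in> set L" "s \<in> {2..n}" "s \<in> S" "s - 1 \<notin> S" by blast
    let ?L = "map (jump_left n s) L"
    have "(\<Sum>S\<leftarrow>?L. \<Sum>S) < (\<Sum>S\<leftarrow>L. \<Sum>S)"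
    proof -
      obtain L1 L2 where L: "L = L1 @ S # L2" using S(1) split_list by metis
      have le: "(\<Sum>S\<leftarrow>L'. \<Sum>(jump_left n s S)) \<le> (\<Sum>S\<leftarrow>L'. \<Sum>S)" if "set L' \<subseteq> set L" for L'
        using that sub S(2) by (intro sum_list_mono sum_jump_left_le) auto
      show ?thesis
        using sum_jump_left_le(2)[OF sub(2)[OF S(1)] S(2-4)] le[of L1] le[of L2]
        unfolding L by (simp add: o_def subset_insertI2 add_mono_thms_linordered_field)
    qed
    moreover have "?L \<in> set_lists n ms"
      using less.prems S(2) by (intro set_lists_jump_left) auto
    ultimately have "(\<lambda>x y. \<exists>s\<in>{1..n}. y = map (jump_left n s) x)\<^sup>*\<^sup>* ?L (map (\<lambda>m. {1..m}) ms)"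
      by (rule less.hyps)
    moreover have "\<exists>s\<in>{1..n}. ?L = map (jump_left n s) L"
      using S(2) by (intro bexI[of _ s]) auto
    ultimately show ?thesis
      by (rule converse_rtranclp_into_rtranclp[rotated])
  qed
qed

section \<open>The queue on a ring\<close>

text \<open>Sites are unrolled to the integers, \<open>site n\<close> being the projection onto \<open>{1..n}\<close>.\<close>

definition site :: "nat \<Rightarrow> int \<Rightarrow> nat" where
  "site n y = nat ((y - 1) mod int n) + 1"

lemma site_int: "s \<in> {1..n} \<Longrightarrow> site n (int s) = s"
  by (auto simp: site_def)

lemma site_in: "n \<ge> 1 \<Longrightarrow> site n y \<in> {1..n}"
proof -
  assume "n \<ge> 1"
  then have "0 \<le> (y - 1) mod int n" "(y - 1) mod int n < int n" by simp_all
  then show ?thesis by (auto simp: site_def)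
qed

lemma site_add: "site n (y + int n * k) = site n y"
proof -
  have "(y + int n * k - 1) mod int n = (y - 1 + int n * k) mod int n" by (simp add: algebra_simps)
  then show ?thesis by (simp add: site_def)
qed

lemma site_pred: "n \<ge> 1 \<Longrightarrow> site n (y - 1) = left_site n (site n y)"
proof -
  assume n: "n \<ge> 1"
  define r where "r = (y - 1) mod int n"
  have r: "0 \<le> r" "r < int n" using n by (simp_all add: r_def)
  have "(y - 1 - 1) mod int n = (r - 1) mod int n" by (simp add: r_def mod_diff_left_eq)
  also have "\<dots> = (if r = 0 then int n - 1 else r - 1)"
    using r n by (auto simp: zmod_minus1 mod_pos_pos_trivial)
  finally show ?thesis using r n by (auto simp: site_def left_site_def r_def[symmetric] nat_diff_distrib)
qed

lemma left_site_neq: "n \<ge> 2 \<Longrightarrow> s \<in> {1..n} \<Longrightarrow> left_site n s \<noteq> s"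
  by (auto simp: left_site_def)

lemma left_site_inj: "s \<in> {1..n} \<Longrightarrow> t \<in> {1..n} \<Longrightarrow> left_site n s = left_site n t \<longleftrightarrow> s = t"
  by (auto simp: left_site_def split: if_splits)

lemma bij_betw_left_site: "bij_betw (left_site n) {1..n} {1..n}"
proof (rule bij_betwI')
  fix y assume "y \<in> {1..n}"
  then show "\<exists>x\<in>{1..n}. y = left_site n x"
    by (intro bexI[of _ "if y = n then 1 else y + 1"]) (auto simp: left_site_def)
qed (use left_site_inj in \<open>auto simp: left_site_def\<close>)

section \<open>Height functions of particle sets\<close>

definition is_height :: "nat \<Rightarrow> nat set \<Rightarrow> (int \<Rightarrow> int) \<Rightarrow> bool" where
  "is_height n S F \<longleftrightarrow> (\<forall>y. F y = F (y - 1) + of_bool (site n y \<in> S))"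

text \<open>The height that vanishes at 0. The predicate \<open>is_height\<close> leaves the
  additive constant open, so that heights after a jump can be given by a local correction.\<close>

definition ring_height :: "nat \<Rightarrow> nat set \<Rightarrow> int \<Rightarrow> int" where
  "ring_height n S y = (if 0 \<le> y then \<Sum>z\<in>{0<..y}. of_bool (site n z \<in> S)
     else - (\<Sum>z\<in>{y<..0}. of_bool (site n z \<in> S)))"

lemma is_height_ring_height: "is_height n S (ring_height n S)"
  unfolding is_height_def
proof
  fix y
  show "ring_height n S y = ring_height n S (y - 1) + of_bool (site n y \<in> S)"
  proof (cases "y \<ge> 1")
    case True
    then have "{0<..y} = insert y {0<..y - 1}" by auto
    then show ?thesis using True by (simp add: ring_height_def)
  next
    case False
    then have "{y - 1<..0} = insert y {y<..0}" by auto
    then show ?thesis using False by (simp add: ring_height_def)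
  qed
qed

lemma int_fun_const:
  fixes f :: "int \<Rightarrow> int"
  assumes "\<And>y. f y = f (y - 1)"
  shows "f x = f y"
proof -
  have "f x = f 0" for x
  proof (induction x rule: int_induct[where k = 0])
    case (step1 i) then show ?case using assms[of "i + 1"] by simp
  next
    case (step2 i) then show ?case using assms[of i] by simp
  qed simp
  then show ?thesis by metis
qed

lemma is_height_diff:
  assumes "is_height n S F" "is_height n S F'"
  shows "F x - F y = F' x - F' y"
proof -
  have "F x - F' x = F y - F' y"
  proof (rule int_fun_const[of "\<lambda>x. F x - F' x"])
    fix y
    have "F y = F (y - 1) + of_bool (site n y \<in> S)" "F' y = F' (y - 1) + of_bool (site n y \<in> S)"
      using assms unfolding is_height_def by blast+
    then show "F y - F' y = F (y - 1) - F' (y - 1)" by linarith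
  qed
  then show ?thesis by simp
qed

lemma sum_site_of_bool:
  assumes "S \<subseteq> {1..n}"
  shows "(\<Sum>s\<in>{1..n}. of_bool (site n (int s) \<in> S)) = int (card S)"
proof -
  have "(\<Sum>s\<in>{1..n}. of_bool (site n (int s) \<in> S)) = (\<Sum>s\<in>{1..n}. of_bool (s \<in> S) :: int)"
    by (intro sum.cong refl) (simp add: site_int)
  also have "\<dots> = int (card S)"
    using assms by (simp add: sum.If_cases of_bool_def Int_absorb1)
  finally show ?thesis .
qed

lemma is_height_period:
  assumes F: "is_height n S F" and S: "S \<subseteq> {1..n}"
  shows "F (y + int n * k) = F y + k * int (card S)"
proof -
  have F1: "F y = F (y - 1) + of_bool (site n y \<in> S)" for y
    using F unfolding is_height_def by blast
  have "F (int m) = F 0 + (\<Sum>s\<in>{1..m}. of_bool (site n (int s) \<in> S))" for m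
  proof (induction m)
    case (Suc m)
    then show ?case using F1[of "int (Suc m)"] by simp
  qed simp
  then have "F (int n) = F 0 + (\<Sum>s\<in>{1..n}. of_bool (site n (int s) \<in> S))" .
  also have "(\<Sum>s\<in>{1..n}. of_bool (site n (int s) \<in> S)) = int (card S)"
    by (rule sum_site_of_bool[OF S])
  finally have n: "F (int n) - F 0 = int (card S)" by simp
  have per1: "F (y + int n) = F y + int (card S)" for y
  proof -
    have "F (y + int n) - F y = F (0 + int n) - F 0"
    proof (rule int_fun_const[of "\<lambda>y. F (y + int n) - F y"])
      fix y
      show "F (y + int n) - F y = F (y - 1 + int n) - F (y - 1)"
        using F1[of "y + int n"] F1[of y] site_add[of n y 1] by (simp add: algebra_simps)
    qed
    then show ?thesis using n by simp
  qed
  show ?thesis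
  proof (induction k rule: int_induct[where k = 0])
    case (step1 i)
    then show ?case using per1[of "y + int n * i"] by (simp add: algebra_simps)
  next
    case (step2 i)
    then show ?case using per1[of "y + int n * (i - 1)"] by (simp add: algebra_simps)
  qed simp
qed

lemma ring_height_0: "ring_height n S 0 = 0"
  by (simp add: ring_height_def)

lemma ring_height_step: "ring_height n S y = ring_height n S (y - 1) + of_bool (site n y \<in> S)"
  using is_height_ring_height unfolding is_height_def by blast

text \<open>Arrivals at \<open>S\<close>, services at \<open>D\<close>, time running to the right. A service at \<open>s\<close> is used when the
  queue is nonempty, that is when over some stretch ending at \<open>s\<close> the arrivals outnumber the
  services before \<open>s\<close>. Unrolling allows arbitrarily long stretches, which makes the local rules below
  free of any comparison between \<open>card S\<close> and \<open>card D\<close>.\<close>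

definition departures :: "nat \<Rightarrow> nat set \<Rightarrow> nat set \<Rightarrow> nat set" where
  "departures n S D = {s \<in> D. \<exists>y<int s.
     ring_height n D (int s - 1) - ring_height n D y < ring_height n S (int s) - ring_height n S y}"

lemma departures_subset: "departures n S D \<subseteq> D"
  by (auto simp: departures_def)

text \<open>Shifting by \<open>k\<close> turns adds \<open>k * (card S - card D)\<close> to both
  sides of the inequality, so the rule may be tested at any lift \<open>x\<close> of the site and
  with heights of any normalisation.\<close>

lemma departures_iff:
  assumes n: "n \<ge> 1" and S: "S \<subseteq> {1..n}" and D: "D \<subseteq> {1..n}"
    and F: "is_height n S F" and G: "is_height n D G"
  shows "site n x \<in> departures n S D \<longleftrightarrow>
    site n x \<in> D \<and> (\<exists>y\<le>x - 1. F y - G y < F x - G (x - 1))"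
proof -
  define k where "k = (x - 1) div int n"
  define s where "s = int (site n x)"
  have x: "x = s + int n * k"
    using n by (simp add: s_def site_def k_def mult_div_mod_eq)
  have "(\<exists>y<s. ring_height n D (s - 1) - ring_height n D y < ring_height n S s - ring_height n S y)
    \<longleftrightarrow> (\<exists>y\<le>s - 1. F y - G y < F s - G (s - 1))"
    using is_height_diff[OF F is_height_ring_height] is_height_diff[OF G is_height_ring_height]
    by (smt (verit, best))
  also have "\<dots> \<longleftrightarrow> (\<exists>y\<le>s - 1. F (y + int n * k) - G (y + int n * k) < F x - G (x - 1))"
  proof -
    have "F (y + int n * k) - G (y + int n * k) < F x - G (x - 1) \<longleftrightarrow> F y - G y < F s - G (s - 1)" for y
      using is_height_period[OF F S, of y k] is_height_period[OF F S, of s k]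
        is_height_period[OF G D, of y k] is_height_period[OF G D, of "s - 1" k]
      by (simp add: x algebra_simps)
    then show ?thesis by simp
  qed
  also have "\<dots> \<longleftrightarrow> (\<exists>y\<le>x - 1. F y - G y < F x - G (x - 1))"
  proof
    assume "\<exists>y\<le>x - 1. F y - G y < F x - G (x - 1)"
    then obtain y where "y \<le> x - 1" "F y - G y < F x - G (x - 1)" by blast
    then show "\<exists>y\<le>s - 1. F (y + int n * k) - G (y + int n * k) < F x - G (x - 1)"
      by (intro exI[of _ "y - int n * k"]) (simp add: x)
  next
    assume "\<exists>y\<le>s - 1. F (y + int n * k) - G (y + int n * k) < F x - G (x - 1)"
    then obtain y where "y \<le> s - 1" "F (y + int n * k) - G (y + int n * k) < F x - G (x - 1)" by blast
    then show "\<exists>y\<le>x - 1. F y - G y < F x - G (x - 1)"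
      by (intro exI[of _ "y + int n * k"]) (simp add: x)
  qed
  finally show ?thesis unfolding departures_def s_def by simp
qed

text \<open>A particle moved from \<open>s\<close> to its left neighbour is counted one site
  earlier, which raises the height by 1 at the lifts of that neighbour and nowhere else.\<close>

lemma is_height_jump_left:
  assumes F: "is_height n S F" and n: "n \<ge> 2" and s: "s \<in> {1..n}"
  shows "is_height n (jump_left n s S)
    (\<lambda>y. F y + of_bool (site n y = left_site n s \<and> s \<in> S \<and> left_site n s \<notin> S))"
  unfolding is_height_def
proof
  fix y
  have t: "site n y \<in> {1..n}" "site n (y - 1) = left_site n (site n y)"
    using n site_in site_pred by auto
  have "left_site n (site n y) = left_site n s \<longleftrightarrow> site n y = s"
    using left_site_inj t s by blast
  moreover have "F y = F (y - 1) + of_bool (site n y \<in> S)" using F unfolding is_height_def by blast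
  moreover have "left_site n s \<noteq> s" using left_site_neq n s by blast
  ultimately show "F y + of_bool (site n y = left_site n s \<and> s \<in> S \<and> left_site n s \<notin> S)
      = F (y - 1) + of_bool (site n (y - 1) = left_site n s \<and> s \<in> S \<and> left_site n s \<notin> S)
        + of_bool (site n y \<in> jump_left n s S)"
    by (auto simp: t(2) jump_left_def)
qed

text \<open>A jump changes the height difference \<open>h\<close> only at isolated places \<open>P\<close>, where its value can be
  traded for that of a neighbour; running minima ending off \<open>P\<close> are therefore unaffected.\<close>

lemma ex_less_iff_perturbed:
  fixes h h' :: "int \<Rightarrow> int"
  assumes eq: "\<And>y. \<not> P y \<Longrightarrow> h' y = h y" and T: "\<not> P T"
    and iso: "\<And>y. P y \<Longrightarrow> \<not> P (y - 1) \<and> \<not> P (y + 1)"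
    and le1: "\<And>y. P y \<Longrightarrow> h (y - 1) \<le> h' y \<or> h y \<le> h' y \<or> h (y + 1) \<le> h' y"
    and le2: "\<And>y. P y \<Longrightarrow> h (y - 1) \<le> h y \<or> h' y \<le> h y \<or> h (y + 1) \<le> h y"
  shows "(\<exists>y\<le>T. h' y < K) \<longleftrightarrow> (\<exists>y\<le>T. h y < K)"
proof
  assume "\<exists>y\<le>T. h' y < K"
  then obtain y where y: "y \<le> T" "h' y < K" by blast
  show "\<exists>y\<le>T. h y < K"
  proof (cases "P y")
    case True
    then have "y + 1 \<le> T" using T y by (cases "y = T") auto
    then show ?thesis using le1[OF True] y by (smt (verit, best))
  qed (use y eq in auto)
next
  assume "\<exists>y\<le>T. h y < K"
  then obtain y where y: "y \<le> T" "h y < K" by blast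
  show "\<exists>y\<le>T. h' y < K"
  proof (cases "P y")
    case True
    then have "y + 1 \<le> T" using T y by (cases "y = T") auto
    moreover have "h' (y - 1) = h (y - 1)" "h' (y + 1) = h (y + 1)" using iso[OF True] eq by auto
    ultimately show ?thesis using le2[OF True] y by (smt (verit, best))
  qed (use y eq in auto)
qed

section \<open>Compatibility of the queue with jumps\<close>

lemma site_set_eqI:
  assumes "A \<subseteq> {1..n}" "B \<subseteq> {1..n}" "\<And>x. site n x \<in> A \<longleftrightarrow> site n x \<in> B"
  shows "A = B"
proof (rule set_eqI)
  fix t
  show "t \<in> A \<longleftrightarrow> t \<in> B"
    using assms site_int[of t n] by (cases "t \<in> {1..n}") (metis, blast)
qed

lemma ex_le_split: "(\<exists>y\<le>z. Q y) \<longleftrightarrow> (\<exists>y\<le>z - 1. Q y) \<or> Q (z :: int)"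
  by (metis le_less zle_diff1_eq)

text \<open>Heights change only over the left neighbour of \<open>s\<close>, so the queue is
  unaffected elsewhere and only the two sites of the bell need a case analysis. The excluded pattern
  is a real obstruction: an arrival moved from \<open>s\<close> to its left neighbour could use the
  service there, while \<open>D\<close> stays put.\<close>

lemma departures_jump_left:
  assumes n: "n \<ge> 2" and s: "s \<in> {1..n}" and S: "S \<subseteq> {1..n}" and D: "D \<subseteq> {1..n}"
    and pat: "\<not> (s \<notin> D \<and> left_site n s \<in> D)"
  shows "departures n (jump_left n s S) (jump_left n s D) = jump_left n s (departures n S D)"
proof (rule site_set_eqI)
  have U: "departures n S D \<subseteq> {1..n}" using departures_subset D by blast
  have S': "jump_left n s S \<subseteq> {1..n}" and D': "jump_left n s D \<subseteq> {1..n}"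
    using jump_left_subset s S D by auto
  show "departures n (jump_left n s S) (jump_left n s D) \<subseteq> {1..n}"
    using departures_subset D' by blast
  show "jump_left n s (departures n S D) \<subseteq> {1..n}"
    using jump_left_subset s U by blast
  fix x
  have n1: "n \<ge> 1" using n by simp
  let ?l = "left_site n s"
  have l: "?l \<in> {1..n}" "?l \<noteq> s" "left_site n ?l \<noteq> ?l"
    using left_site_in left_site_neq n s by auto
  define F where "F = ring_height n S"
  define G where "G = ring_height n D"
  have FG: "is_height n S F" "is_height n D G" by (simp_all add: F_def G_def is_height_ring_height)
  have F1: "F y = F (y - 1) + of_bool (site n y \<in> S)" and G1: "G y = G (y - 1) + of_bool (site n y \<in> D)" for y
    using FG unfolding is_height_def by blast+
  define F' where "F' y = F y + of_bool (site n y = ?l \<and> s \<in> S \<and> ?l \<notin> S)" for y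
  define G' where "G' y = G y + of_bool (site n y = ?l \<and> s \<in> D \<and> ?l \<notin> D)" for y
  have FG': "is_height n (jump_left n s S) F'" "is_height n (jump_left n s D) G'"
    unfolding F'_def G'_def using is_height_jump_left FG n s by blast+
  have dep: "site n x \<in> departures n S D \<longleftrightarrow>
      site n x \<in> D \<and> (\<exists>y\<le>x - 1. F y - G y < F x - G (x - 1))" for x
    using departures_iff[OF n1 S D FG] .
  have dep': "site n x \<in> departures n (jump_left n s S) (jump_left n s D) \<longleftrightarrow>
      site n x \<in> jump_left n s D \<and> (\<exists>y\<le>x - 1. F' y - G' y < F' x - G' (x - 1))" for x
    using departures_iff[OF n1 S' D' FG'] .
  have left: "site n (y - 1) = left_site n (site n y)" for y using site_pred n1 by blast
  have site_s: "site n (y + 1) = s" if "site n y = ?l" for y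
  proof -
    have "left_site n (site n (y + 1)) = ?l"
      using that left[of "y + 1"] by (simp only: add_diff_cancel_right')
    then show ?thesis using left_site_inj[OF site_in[OF n1] s] by blast
  qed
  have inf: "(\<exists>y\<le>T. F' y - G' y < K) \<longleftrightarrow> (\<exists>y\<le>T. F y - G y < K)" if T: "site n T \<noteq> ?l" for T K
  proof (rule ex_less_iff_perturbed[where P = "\<lambda>y. site n y = ?l"])
    fix y
    show "site n y \<noteq> ?l \<Longrightarrow> F' y - G' y = F y - G y" by (simp add: F'_def G'_def)
    assume y: "site n y = ?l"
    show "site n (y - 1) \<noteq> ?l \<and> site n (y + 1) \<noteq> ?l" using site_s y left l by auto
    have "F y = F (y - 1) + of_bool (?l \<in> S)" "G y = G (y - 1) + of_bool (?l \<in> D)"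
      "F (y + 1) = F y + of_bool (s \<in> S)" "G (y + 1) = G y + of_bool (s \<in> D)"
      using F1[of y] G1[of y] F1[of "y + 1"] G1[of "y + 1"] y site_s[OF y] by simp_all
    then show "F (y - 1) - G (y - 1) \<le> F' y - G' y \<or> F y - G y \<le> F' y - G' y
        \<or> F (y + 1) - G (y + 1) \<le> F' y - G' y"
      and "F (y - 1) - G (y - 1) \<le> F y - G y \<or> F' y - G' y \<le> F y - G y
        \<or> F (y + 1) - G (y + 1) \<le> F y - G y"
      using pat y by (auto simp: F'_def G'_def of_bool_def)
  qed (rule T)
  \<comment> \<open>A bell sorts the two sites: afterwards the left one is occupied iff one of them
    was, the right one iff both were. The departures follow this rule.\<close>
  have pair: "(?l \<in> departures n (jump_left n s S) (jump_left n s D) \<longleftrightarrow>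
         ?l \<in> departures n S D \<or> s \<in> departures n S D) \<and>
      (s \<in> departures n (jump_left n s S) (jump_left n s D) \<longleftrightarrow>
         ?l \<in> departures n S D \<and> s \<in> departures n S D)" if z: "site n z = ?l" for z
  proof -
    define A where "A K \<longleftrightarrow> (\<exists>y\<le>z - 1. F y - G y < K)" for K
    have sz: "site n (z + 1) = s" using site_s z .
    have zl: "site n (z - 1) \<noteq> ?l" using left z l by simp
    have A_mono: "A K \<Longrightarrow> K \<le> K' \<Longrightarrow> A K'" for K K'
      unfolding A_def by (meson less_le_trans)
    have A_pos: "F (z - 1) - G (z - 1) < K \<Longrightarrow> A K" for K
      unfolding A_def by blast
    have A': "(\<exists>y\<le>z - 1. F' y - G' y < K) \<longleftrightarrow> A K" for K
      unfolding A_def using inf[OF zl] .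
    have heights: "F z = F (z - 1) + of_bool (?l \<in> S)" "G z = G (z - 1) + of_bool (?l \<in> D)"
      "F (z + 1) = F z + of_bool (s \<in> S)" "G (z + 1) = G z + of_bool (s \<in> D)"
      "F' z = F z + of_bool (s \<in> S \<and> ?l \<notin> S)" "G' z = G z + of_bool (s \<in> D \<and> ?l \<notin> D)"
      "F' (z + 1) = F (z + 1)" "G' (z - 1) = G (z - 1)"
      using F1[of z] G1[of z] F1[of "z + 1"] G1[of "z + 1"] z sz zl l by (simp_all add: F'_def G'_def)
    have d1: "?l \<in> departures n S D \<longleftrightarrow> ?l \<in> D \<and> A (F z - G (z - 1))"
      using dep[of z] z by (simp add: A_def)
    have d2: "s \<in> departures n S D \<longleftrightarrow> s \<in> D \<and> (A (F (z + 1) - G z) \<or> F z - G z < F (z + 1) - G z)"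
      using dep[of "z + 1"] sz by (simp add: A_def ex_le_split[of z])
    have d1': "?l \<in> departures n (jump_left n s S) (jump_left n s D)
        \<longleftrightarrow> ?l \<in> jump_left n s D \<and> A (F' z - G' (z - 1))"
      using dep'[of z] unfolding z A' .
    have d2': "s \<in> departures n (jump_left n s S) (jump_left n s D)
        \<longleftrightarrow> s \<in> jump_left n s D \<and> (A (F' (z + 1) - G' z) \<or> F' z - G' z < F' (z + 1) - G' z)"
      using dep'[of "z + 1"] unfolding sz add_diff_cancel_right' ex_le_split[of z] A' .
    \<comment> \<open>With \<open>K\<close> the height difference just before the pair,
      \<open>A K\<close> says that a customer is waiting there and \<open>A (K - 1)\<close> that at
      least two are. The other arguments of \<open>A\<close> that occur are \<open>K + 1\<close> and
      \<open>K + 2\<close>, where it holds trivially.\<close>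
    define K where "K = F (z - 1) - G (z - 1)"
    have Fz: "F (z - 1) = K + G (z - 1)" by (simp add: K_def)
    have A1: "A (K + 1)" "A (K + 2)" using A_pos by (simp_all add: K_def)
    have A0: "A (K - 1) \<Longrightarrow> A K" using A_mono[of "K - 1" K] by simp
    show ?thesis
      unfolding d1 d2 d1' d2' heights Fz
      using pat A1 A0 l(2)
      by (cases "?l \<in> S"; cases "s \<in> S"; cases "?l \<in> D"; cases "s \<in> D")
        (auto simp: jump_left_def algebra_simps)
  qed
  show "site n x \<in> departures n (jump_left n s S) (jump_left n s D) \<longleftrightarrow>
      site n x \<in> jump_left n s (departures n S D)"
  proof -
    consider "site n x = ?l" | "site n x = s" | "site n x \<noteq> ?l" "site n x \<noteq> s" by blast
    then show ?thesis
    proof cases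
      case 1
      then show ?thesis using pair[OF 1] l(2) by (auto simp: jump_left_def)
    next
      case 2
      then have "site n (x - 1) = ?l" using left by simp
      from pair[OF this] show ?thesis using 2 l(2) by (auto simp: jump_left_def)
    next
      case 3
      then have x1: "site n (x - 1) \<noteq> ?l" using left left_site_inj[OF site_in[OF n1] s] by simp
      have "F' x = F x" "G' (x - 1) = G (x - 1)" using 3 x1 by (simp_all add: F'_def G'_def)
      moreover have "site n x \<in> jump_left n s A \<longleftrightarrow> site n x \<in> A" for A
        using 3 by (auto simp: jump_left_def)
      ultimately show ?thesis using dep[of x] dep'[of x] inf[OF x1] by simp
    qed
  qed
qed

text \<open>Without a service at the left neighbour of \<open>s\<close>, an arrival at either of the
  two sites meets its first service at \<open>s\<close>, so it does not matter on which of them it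
  came.\<close>

lemma departures_jump_left_arrivals:
  assumes n: "n \<ge> 2" and s: "s \<in> {1..n}" and S: "S \<subseteq> {1..n}" and D: "D \<subseteq> {1..n}"
    and pat: "s \<in> D" "left_site n s \<notin> D"
  shows "departures n (jump_left n s S) D = departures n S D"
proof (rule site_set_eqI)
  have S': "jump_left n s S \<subseteq> {1..n}"
    using jump_left_subset s S by auto
  show "departures n (jump_left n s S) D \<subseteq> {1..n}" "departures n S D \<subseteq> {1..n}"
    using departures_subset D by blast+
  fix x
  have n1: "n \<ge> 1" using n by simp
  let ?l = "left_site n s"
  have l: "?l \<in> {1..n}" "?l \<noteq> s" "left_site n ?l \<noteq> ?l"
    using left_site_in left_site_neq n s by auto
  define F where "F = ring_height n S"
  define G where "G = ring_height n D"
  have FG: "is_height n S F" "is_height n D G" by (simp_all add: F_def G_def is_height_ring_height)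
  have F1: "F y = F (y - 1) + of_bool (site n y \<in> S)" and G1: "G y = G (y - 1) + of_bool (site n y \<in> D)" for y
    using FG unfolding is_height_def by blast+
  define F' where "F' y = F y + of_bool (site n y = ?l \<and> s \<in> S \<and> ?l \<notin> S)" for y
  have F': "is_height n (jump_left n s S) F'"
    unfolding F'_def using is_height_jump_left FG n s by blast
  have dep: "site n x \<in> departures n S D \<longleftrightarrow>
      site n x \<in> D \<and> (\<exists>y\<le>x - 1. F y - G y < F x - G (x - 1))" for x
    using departures_iff[OF n1 S D FG] .
  have dep': "site n x \<in> departures n (jump_left n s S) D \<longleftrightarrow>
      site n x \<in> D \<and> (\<exists>y\<le>x - 1. F' y - G y < F' x - G (x - 1))" for x
    using departures_iff[OF n1 S' D F' FG(2)] .
  have left: "site n (y - 1) = left_site n (site n y)" for y using site_pred n1 by blast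
  have site_s: "site n (y + 1) = s" if "site n y = ?l" for y
  proof -
    have "left_site n (site n (y + 1)) = ?l"
      using that left[of "y + 1"] by (simp only: add_diff_cancel_right')
    then show ?thesis using left_site_inj[OF site_in[OF n1] s] by blast
  qed
  have heights: "F y = F (y - 1) + of_bool (?l \<in> S)" "G y = G (y - 1)"
      "F (y + 1) = F y + of_bool (s \<in> S)" "G (y + 1) = G y + 1"
      "F' y = F y + of_bool (s \<in> S \<and> ?l \<notin> S)" if y: "site n y = ?l" for y
      using F1[of y] G1[of y] F1[of "y + 1"] G1[of "y + 1"] y site_s[OF y] pat by (simp_all add: F'_def)
  have inf: "(\<exists>y\<le>T. F' y - G y < K) \<longleftrightarrow> (\<exists>y\<le>T. F y - G y < K)" if T: "site n T \<noteq> ?l" for T K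
  proof (rule ex_less_iff_perturbed[where P = "\<lambda>y. site n y = ?l"])
    fix y
    show "site n y \<noteq> ?l \<Longrightarrow> F' y - G y = F y - G y" by (simp add: F'_def)
    assume y: "site n y = ?l"
    show "site n (y - 1) \<noteq> ?l \<and> site n (y + 1) \<noteq> ?l" using site_s y left l by auto
    show "F (y - 1) - G (y - 1) \<le> F' y - G y \<or> F y - G y \<le> F' y - G y
        \<or> F (y + 1) - G (y + 1) \<le> F' y - G y"
      and "F (y - 1) - G (y - 1) \<le> F y - G y \<or> F' y - G y \<le> F y - G y
        \<or> F (y + 1) - G (y + 1) \<le> F y - G y"
      using heights[OF y] by (auto simp: of_bool_def)
  qed (rule T)
  show "site n x \<in> departures n (jump_left n s S) D \<longleftrightarrow> site n x \<in> departures n S D"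
  proof -
    consider "site n x = ?l" | "site n x = s" | "site n x \<noteq> ?l" "site n x \<noteq> s" by blast
    then show ?thesis
    proof cases
      case 1
      then show ?thesis using dep[of x] dep'[of x] pat by simp
    next
      case 2
      define z where "z = x - 1"
      have x: "x = z + 1" by (simp add: z_def)
      have z: "site n z = ?l" using left 2 by (simp add: z_def)
      have zl: "site n (z - 1) \<noteq> ?l" using left z l by simp
      define A where "A K \<longleftrightarrow> (\<exists>y\<le>z - 1. F y - G y < K)" for K
      have A': "(\<exists>y\<le>z - 1. F' y - G y < K) \<longleftrightarrow> A K" for K
        unfolding A_def using inf[OF zl] .
      have "A (F (z + 1) - G z)" if "s \<in> S \<or> ?l \<in> S"
        unfolding A_def using heights[OF z] that by (intro exI[of _ "z - 1"]) auto
      moreover have "F' (z + 1) = F (z + 1)" using 2 l(2) x by (simp add: F'_def)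
      ultimately have "(\<exists>y\<le>z. F' y - G y < F' (z + 1) - G z) \<longleftrightarrow> (\<exists>y\<le>z. F y - G y < F (z + 1) - G z)"
        unfolding ex_le_split[of z] A' A_def[symmetric] using heights[OF z] by auto
      then show ?thesis using dep[of x] dep'[of x] unfolding x add_diff_cancel_right' by simp
    next
      case 3
      then have x1: "site n (x - 1) \<noteq> ?l" using left left_site_inj[OF site_in[OF n1] s] by simp
      have "F' x = F x" using 3 by (simp add: F'_def)
      then show ?thesis using dep[of x] dep'[of x] inf[OF x1] by simp
    qed
  qed
qed

text \<open>With \<open>M\<close> the running minimum of the height difference, a service is unused exactly where \<open>M\<close>
  drops; over one period \<open>M\<close> drops by \<open>card D - card S\<close>.\<close>

lemma card_departures:
  assumes n: "n \<ge> 1" and S: "S \<subseteq> {1..n}" and D: "D \<subseteq> {1..n}" and le: "card S \<le> card D"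
  shows "card (departures n S D) = card S"
proof -
  define h where "h y = ring_height n S y - ring_height n D y" for y
  define e where "e = int (card D) - int (card S)"
  have e: "e \<ge> 0" using le by (simp add: e_def)
  have per: "h (y + int n * k) = h y - e * k" for y k
    using is_height_period[OF is_height_ring_height S, of y k] is_height_period[OF is_height_ring_height D, of y k]
    by (simp add: h_def e_def algebra_simps)
  \<comment> \<open>Since \<open>card S \<le> card D\<close>, moving right by full turns never
    raises \<open>h\<close>; hence the minimum over the last \<open>n\<close> places is the minimum
    over the whole half-line.\<close>
  have "\<exists>m. (\<forall>y\<le>x. m \<le> h y) \<and> (\<exists>y\<le>x. h y = m)" for x
  proof -
    let ?W = "h ` {x - int n<..x}"
    have W: "finite ?W" "?W \<noteq> {}" using n by auto
    have "Min ?W \<le> h y" if "y \<le> x" for y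
    proof -
      define k where "k = (x - y) div int n"
      have "k \<ge> 0" using that n by (simp add: k_def pos_imp_zdiv_nonneg_iff)
      have "0 \<le> (x - y) mod int n" "(x - y) mod int n < int n" using n by simp_all
      moreover have "(x - y) mod int n = x - (y + int n * k)"
        by (simp add: k_def minus_mult_div_eq_mod[symmetric])
      ultimately have "y + int n * k \<in> {x - int n<..x}" by auto
      then have "Min ?W \<le> h (y + int n * k)" using W by (intro Min_le) auto
      also have "\<dots> \<le> h y" using per e \<open>k \<ge> 0\<close> by simp
      finally show ?thesis .
    qed
    moreover have "\<exists>y\<le>x. h y = Min ?W" using Min_in[OF W] by auto
    ultimately show ?thesis by blast
  qed
  then obtain M where M: "\<And>x y. y \<le> x \<Longrightarrow> M x \<le> h y" "\<And>x. \<exists>y\<le>x. h y = M x"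
    by metis
  have M_rec: "M x = min (M (x - 1)) (h x)" for x
  proof -
    obtain y1 y2 where y: "y1 \<le> x" "h y1 = M x" "y2 \<le> x - 1" "h y2 = M (x - 1)" using M(2) by metis
    have "M x \<le> M (x - 1)" using M(1)[of y2 x] y by simp
    moreover have "M x \<le> h x" using M(1) by simp
    moreover have "y1 = x \<or> M (x - 1) \<le> h y1" using M(1)[of y1 "x - 1"] y by force
    ultimately show ?thesis using y by auto
  qed
  have M_per: "M (x + int n) = M x - e" for x
  proof (rule antisym)
    obtain y where "y \<le> x" "h y = M x" using M(2) by blast
    then show "M (x + int n) \<le> M x - e" using M(1)[of "y + int n" "x + int n"] per[of y 1] by simp
    obtain y where "y \<le> x + int n" "h y = M (x + int n)" using M(2) by blast
    then show "M x - e \<le> M (x + int n)" using M(1)[of "y - int n" x] per[of "y - int n" 1] by simp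
  qed
  have dep: "of_bool (site n x \<in> departures n S D) = of_bool (site n x \<in> D) + M x - M (x - 1)" for x
  proof -
    define K where "K = ring_height n S x - ring_height n D (x - 1)"
    have "(\<exists>y\<le>x - 1. h y < K) \<longleftrightarrow> M (x - 1) < K"
    proof
      assume "M (x - 1) < K"
      then show "\<exists>y\<le>x - 1. h y < K" using M(2)[of "x - 1"] by metis
    qed (use M(1) in \<open>meson le_less_trans\<close>)
    then have d: "site n x \<in> departures n S D \<longleftrightarrow> site n x \<in> D \<and> M (x - 1) < K"
      using departures_iff[OF n S D is_height_ring_height is_height_ring_height, of x] by (simp add: K_def h_def)
    have hx: "h x = K - of_bool (site n x \<in> D)"
      using ring_height_step[of n D x] by (simp add: h_def K_def)
    have "K = h (x - 1) + of_bool (site n x \<in> S)"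
      using ring_height_step[of n S x] by (simp add: h_def K_def)
    moreover have "M (x - 1) \<le> h (x - 1)" using M(1) by simp
    ultimately have "M (x - 1) \<le> K" by (simp add: of_bool_def split: if_splits)
    then show ?thesis unfolding d M_rec[of x] hx by (auto simp: min_def)
  qed
  have "int (card (departures n S D)) = (\<Sum>s\<in>{1..n}. of_bool (site n (int s) \<in> departures n S D))"
    using departures_subset D by (intro sum_site_of_bool[symmetric]) blast
  also have "\<dots> = (\<Sum>s\<in>{1..n}. of_bool (site n (int s) \<in> D)) + (\<Sum>s\<in>{1..n}. M (int s) - M (int s - 1))"
    by (simp add: dep sum.distrib sum_subtractf algebra_simps)
  also have "(\<Sum>s\<in>{1..m}. M (int s) - M (int s - 1)) = M (int m) - M 0" for m
    by (induction m) simp_all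
  also have "M (int n) - M 0 = - e" using M_per[of 0] by simp
  finally show ?thesis unfolding sum_site_of_bool[OF D] e_def by simp
qed

section \<open>Multiline queues are stationary\<close>

text \<open>The image under \<open>Y\<close> of the uniform law on \<open>\<Omega>\<close> is invariant for the chain of simultaneous jumps
  of all sets in the list.\<close>

definition ring_stationary :: "nat \<Rightarrow> 'b set \<Rightarrow> ('b \<Rightarrow> nat set list) \<Rightarrow> bool" where
  "ring_stationary n \<Omega> Y \<longleftrightarrow> (\<forall>f :: nat set list \<Rightarrow> real.
     (\<Sum>\<omega>\<in>\<Omega>. \<Sum>s\<in>{1..n}. f (map (jump_left n s) (Y \<omega>))) = real n * (\<Sum>\<omega>\<in>\<Omega>. f (Y \<omega>)))"

text \<open>One more row of a multiline queue: \<open>D\<close> serves every set of the list and is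
  itself appended as the largest class.\<close>

definition serve :: "nat \<Rightarrow> nat set list \<Rightarrow> nat set \<Rightarrow> nat set list" where
  "serve n L D = map (\<lambda>S. departures n S D) L @ [D]"

text \<open>Around the ring, runs of \<open>D\<close> end as often as they begin.\<close>

lemma card_ascents_eq_descents:
  assumes D: "D \<subseteq> {1..n}"
  shows "card {s\<in>{1..n}. s \<notin> D \<and> left_site n s \<in> D} = card {s\<in>{1..n}. s \<in> D \<and> left_site n s \<notin> D}"
proof -
  let ?I = "{1..n}"
  have "card {s\<in>?I. left_site n s \<in> D} = card D"
  proof (rule bij_betw_same_card)
    have "left_site n ` {s\<in>?I. left_site n s \<in> D} = left_site n ` ?I \<inter> D" by auto
    also have "\<dots> = D" using D bij_betw_left_site[of n] unfolding bij_betw_def by auto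
    finally have "left_site n ` {s\<in>?I. left_site n s \<in> D} = D" .
    then show "bij_betw (left_site n) {s\<in>?I. left_site n s \<in> D} D"
      using bij_betw_left_site[of n] unfolding bij_betw_def by (auto intro: inj_on_subset)
  qed
  moreover have "{s\<in>?I. s \<in> D} = D" using D by auto
  moreover have "card {s\<in>?I. left_site n s \<in> D}
      = card {s\<in>?I. s \<notin> D \<and> left_site n s \<in> D} + card {s\<in>?I. s \<in> D \<and> left_site n s \<in> D}"
    by (subst card_Un_disjoint[symmetric]) (auto intro: arg_cong[where f = card])
  moreover have "card {s\<in>?I. s \<in> D}
      = card {s\<in>?I. s \<in> D \<and> left_site n s \<notin> D} + card {s\<in>?I. s \<in> D \<and> left_site n s \<in> D}"
    by (subst card_Un_disjoint[symmetric]) (auto intro: arg_cong[where f = card])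
  ultimately show ?thesis by simp
qed

text \<open>In the second case every set of the output lies in \<open>D\<close>, so none has a
  particle at \<open>s\<close> that could jump. In the third, the bell rings for the arrivals alone
  and the output does not notice.\<close>

lemma serve_jump_left:
  assumes n: "n \<ge> 2" and s: "s \<in> {1..n}" and L: "set L \<subseteq> Pow {1..n}" and D: "D \<subseteq> {1..n}"
  shows "\<not> (s \<notin> D \<and> left_site n s \<in> D) \<Longrightarrow>
      map (jump_left n s) (serve n L D) = serve n (map (jump_left n s) L) (jump_left n s D)"
    and "s \<notin> D \<Longrightarrow> map (jump_left n s) (serve n L D) = serve n L D"
    and "s \<in> D \<Longrightarrow> left_site n s \<notin> D \<Longrightarrow> serve n (map (jump_left n s) L) D = serve n L D"
proof -
  have sub: "S \<subseteq> {1..n}" if "S \<in> set L" for S using L that by blast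
  show "map (jump_left n s) (serve n L D) = serve n (map (jump_left n s) L) (jump_left n s D)"
    if "\<not> (s \<notin> D \<and> left_site n s \<in> D)"
    using departures_jump_left[OF n s sub D that] by (simp add: serve_def)
  show "map (jump_left n s) (serve n L D) = serve n L D" if "s \<notin> D"
    using departures_subset[of n _ D] that by (auto simp: serve_def jump_left_def)
  show "serve n (map (jump_left n s) L) D = serve n L D" if "s \<in> D" "left_site n s \<notin> D"
    using departures_jump_left_arrivals[OF n s sub D that] by (simp add: serve_def)
qed

lemma sum_of_bool_mult_filter:
  fixes h :: "'b \<Rightarrow> real"
  assumes "finite A"
  shows "(\<Sum>x\<in>A. of_bool (P x) * h x) = sum h {x\<in>A. P x}"
  unfolding sum.inter_filter[OF assms] by (intro sum.cong) auto

text \<open>For given \<open>D\<close>, the sites \<open>s \<notin> D\<close> with a particle of \<open>D\<close> on their left, where a bell has no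
  effect on the output, are as many as the sites \<open>s \<in> D\<close> with a hole on their left, where the arrivals may
  jump without changing the departures. Trading the former for the latter turns a uniformly chosen
  bell of the output into a uniformly chosen bell of the input.\<close>

lemma sum_serve_jump_left:
  fixes f :: "nat set list \<Rightarrow> real" and d :: nat
  assumes n: "n \<ge> 2" and L: "set L \<subseteq> Pow {1..n}"
  defines "\<D> \<equiv> {D. D \<subseteq> {1..n} \<and> card D = (d::nat)}"
  shows "(\<Sum>D\<in>\<D>. \<Sum>s\<in>{1..n}. f (map (jump_left n s) (serve n L D)))
    = (\<Sum>D\<in>\<D>. \<Sum>s\<in>{1..n}. f (serve n (map (jump_left n s) L) D))"
proof -
  let ?I = "{1..n}"
  let ?up = "\<lambda>D s. s \<in> D \<and> left_site n s \<notin> D"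
  let ?dn = "\<lambda>D s. s \<notin> D \<and> left_site n s \<in> D"
  let ?g = "\<lambda>s D. f (serve n (map (jump_left n s) L) D)"
  have fin: "finite \<D>" unfolding \<D>_def by (rule finite_subset[of _ "Pow ?I"]) auto
  have blocked: "(\<Sum>s\<in>?I. of_bool (?dn D s) * f (serve n L D)) = (\<Sum>s\<in>?I. of_bool (?up D s) * ?g s D)"
    if "D \<in> \<D>" for D
  proof -
    have D: "D \<subseteq> ?I" using that by (simp add: \<D>_def)
    have "(\<Sum>s\<in>?I. of_bool (?dn D s) * f (serve n L D))
        = real (card {s\<in>?I. ?dn D s}) * f (serve n L D)"
      by (simp only: sum_of_bool_mult_filter[OF finite_atLeastAtMost] sum_constant)
    also have "\<dots> = real (card {s\<in>?I. ?up D s}) * f (serve n L D)"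
      by (simp only: card_ascents_eq_descents[OF D])
    also have "\<dots> = (\<Sum>s\<in>?I. of_bool (?up D s) * f (serve n L D))"
      by (simp only: sum_of_bool_mult_filter[OF finite_atLeastAtMost] sum_constant)
    also have "\<dots> = (\<Sum>s\<in>?I. of_bool (?up D s) * ?g s D)"
    proof (intro sum.cong refl)
      fix s assume "s \<in> ?I"
      then show "of_bool (?up D s) * f (serve n L D) = of_bool (?up D s) * ?g s D"
        using serve_jump_left(3)[OF n _ L D, of s] by (cases "?up D s") simp_all
    qed
    finally show ?thesis .
  qed
  \<comment> \<open>\<open>jump_left n s\<close> is a size-preserving bijection from the service
    rows with a particle at \<open>s\<close> and a hole on its left to those with the opposite
    pattern.\<close>
  have swapped: "(\<Sum>D\<in>\<D>. of_bool (?up D s) * ?g s (jump_left n s D)) = (\<Sum>D\<in>\<D>. of_bool (?dn D s) * ?g s D)"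
    if s: "s \<in> ?I" for s
  proof -
    have ls: "left_site n s \<in> ?I" "left_site n s \<noteq> s"
      using left_site_in s left_site_neq[OF n s] by auto
    have "(\<Sum>D\<in>{D\<in>\<D>. ?up D s}. ?g s (jump_left n s D)) = (\<Sum>D\<in>{D\<in>\<D>. ?dn D s}. ?g s D)"
    proof (rule sum.reindex_bij_witness[where j = "jump_left n s"
          and i = "\<lambda>D. insert s (D - {left_site n s})"])
      fix D assume D: "D \<in> {D\<in>\<D>. ?up D s}"
      then show "insert s (jump_left n s D - {left_site n s}) = D"
        by (auto simp: jump_left_def)
      have "finite D" using D finite_subset[of D ?I] by (auto simp: \<D>_def)
      then have "jump_left n s D \<in> \<D>"
        using D jump_left_subset[OF s, of D] card_jump_left[of D n s] by (simp add: \<D>_def)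
      moreover have "s \<notin> jump_left n s D" "left_site n s \<in> jump_left n s D"
        using D ls by (simp_all add: jump_left_def)
      ultimately show "jump_left n s D \<in> {D\<in>\<D>. ?dn D s}" by blast
    next
      fix D assume D: "D \<in> {D\<in>\<D>. ?dn D s}"
      then have "finite D" using finite_subset[of D ?I] by (auto simp: \<D>_def)
      then have "card (insert s (D - {left_site n s})) = card D"
        using D card_Suc_Diff1[of D "left_site n s"] by (simp del: card_Diff_insert card_Diff_singleton)
      then show "insert s (D - {left_site n s}) \<in> {D\<in>\<D>. ?up D s}"
        using D ls s by (auto simp: \<D>_def)
      show "jump_left n s (insert s (D - {left_site n s})) = D"
        using D ls by (auto simp: jump_left_def)
    qed auto
    then show ?thesis unfolding sum_of_bool_mult_filter[OF fin] .
  qed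
  have "(\<Sum>D\<in>\<D>. \<Sum>s\<in>?I. f (map (jump_left n s) (serve n L D)))
    = (\<Sum>D\<in>\<D>. \<Sum>s\<in>?I. of_bool (?dn D s) * f (serve n L D)
        + of_bool (?up D s) * ?g s (jump_left n s D)
        + of_bool (\<not> ?up D s \<and> \<not> ?dn D s) * ?g s D)"
  proof (intro sum.cong refl)
    fix D s assume Ds: "D \<in> \<D>" "s \<in> ?I"
    then have D: "D \<subseteq> ?I" by (simp add: \<D>_def)
    show "f (map (jump_left n s) (serve n L D)) = of_bool (?dn D s) * f (serve n L D)
        + of_bool (?up D s) * ?g s (jump_left n s D)
        + of_bool (\<not> ?up D s \<and> \<not> ?dn D s) * ?g s D"
    proof (cases "?dn D s")
      case True
      then show ?thesis using serve_jump_left(2)[OF n Ds(2) L D] by simp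
    next
      case False
      have "jump_left n s D = D" if "\<not> ?up D s" using that by (auto simp: jump_left_def)
      then show ?thesis using serve_jump_left(1)[OF n Ds(2) L D False] False
        by (cases "s \<in> D"; cases "left_site n s \<in> D") simp_all
    qed
  qed
  \<comment> \<open>The blocked bells (\<open>?dn\<close>) stand in for the input bells with pattern
    \<open>?up\<close>, while the bells that move \<open>D\<close> (\<open>?up\<close>), reindexed
    by the moved row, provide those with pattern \<open>?dn\<close>.\<close>
  also have "\<dots> = (\<Sum>D\<in>\<D>. \<Sum>s\<in>?I. of_bool (?up D s) * ?g s D)
      + (\<Sum>s\<in>?I. \<Sum>D\<in>\<D>. of_bool (?up D s) * ?g s (jump_left n s D))
      + (\<Sum>D\<in>\<D>. \<Sum>s\<in>?I. of_bool (\<not> ?up D s \<and> \<not> ?dn D s) * ?g s D)"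
    by (simp only: sum.distrib sum.swap[of _ ?I \<D>] blocked cong: sum.cong)
  also have "(\<Sum>s\<in>?I. \<Sum>D\<in>\<D>. of_bool (?up D s) * ?g s (jump_left n s D))
      = (\<Sum>D\<in>\<D>. \<Sum>s\<in>?I. of_bool (?dn D s) * ?g s D)"
    by (simp only: swapped sum.swap[of _ \<D> ?I] cong: sum.cong)
  also have "(\<Sum>D\<in>\<D>. \<Sum>s\<in>?I. of_bool (?up D s) * ?g s D)
      + (\<Sum>D\<in>\<D>. \<Sum>s\<in>?I. of_bool (?dn D s) * ?g s D)
      + (\<Sum>D\<in>\<D>. \<Sum>s\<in>?I. of_bool (\<not> ?up D s \<and> \<not> ?dn D s) * ?g s D)
      = (\<Sum>D\<in>\<D>. \<Sum>s\<in>?I. ?g s D)"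
    unfolding sum.distrib[symmetric] by (intro sum.cong refl) (auto simp: of_bool_def)
  finally show ?thesis .
qed

text \<open>The new row is independent of the old system, so the hypothesis applies to the test
  function that sums \<open>f (serve n L D)\<close> over \<open>D\<close>.\<close>

lemma ring_stationary_serve:
  assumes n: "n \<ge> 2" and st: "ring_stationary n \<Omega> Y"
    and Y: "\<And>\<omega>. \<omega> \<in> \<Omega> \<Longrightarrow> set (Y \<omega>) \<subseteq> Pow {1..n}"
  shows "ring_stationary n (\<Omega> \<times> {D. D \<subseteq> {1..n} \<and> card D = d}) (\<lambda>(\<omega>, D). serve n (Y \<omega>) D)"
  unfolding ring_stationary_def
proof
  fix f :: "nat set list \<Rightarrow> real"
  let ?D = "{D. D \<subseteq> {1..n} \<and> card D = d}"
  have "(\<Sum>\<omega>\<in>\<Omega>. \<Sum>D\<in>?D. \<Sum>s\<in>{1..n}. f (map (jump_left n s) (serve n (Y \<omega>) D)))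
    = (\<Sum>\<omega>\<in>\<Omega>. \<Sum>D\<in>?D. \<Sum>s\<in>{1..n}. f (serve n (map (jump_left n s) (Y \<omega>)) D))"
    using Y by (intro sum.cong refl sum_serve_jump_left n)
  also have "\<dots> = (\<Sum>\<omega>\<in>\<Omega>. \<Sum>s\<in>{1..n}. \<Sum>D\<in>?D. f (serve n (map (jump_left n s) (Y \<omega>)) D))"
    by (intro sum.cong refl sum.swap)
  also have "\<dots> = real n * (\<Sum>\<omega>\<in>\<Omega>. \<Sum>D\<in>?D. f (serve n (Y \<omega>) D))"
    using st[unfolded ring_stationary_def, rule_format, of "\<lambda>L. \<Sum>D\<in>?D. f (serve n L D)"] .
  finally show "(\<Sum>\<omega>\<in>\<Omega> \<times> ?D. \<Sum>s\<in>{1..n}. f (map (jump_left n s) (case \<omega> of (\<omega>, D) \<Rightarrow> serve n (Y \<omega>) D)))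
      = real n * (\<Sum>\<omega>\<in>\<Omega> \<times> ?D. f (case \<omega> of (\<omega>, D) \<Rightarrow> serve n (Y \<omega>) D))"
    unfolding sum.cartesian_product' prod.case .
qed

section \<open>Transfer between permutations and lists of sets\<close>

lemma sum_pushforward:
  fixes p :: "'a \<Rightarrow> real"
  assumes "finite A" "finite X" "\<And>w. w \<in> A \<Longrightarrow> T w \<in> X"
  shows "(\<Sum>L\<in>X. (\<Sum>w\<in>{w\<in>A. T w = L}. p w) * g L) = (\<Sum>w\<in>A. p w * g (T w))"
proof -
  have "(\<Sum>L\<in>X. (\<Sum>w\<in>{w\<in>A. T w = L}. p w) * g L)
      = (\<Sum>L\<in>X. \<Sum>w\<in>{w\<in>A. T w = L}. p w * g (T w))"
    unfolding sum_distrib_right by (intro sum.cong refl) auto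
  also have "\<dots> = (\<Sum>w\<in>A. p w * g (T w))"
    using assms by (intro sum.group) auto
  finally show ?thesis .
qed

definition thresholds :: "nat \<Rightarrow> nat list \<Rightarrow> (nat \<Rightarrow> nat) \<Rightarrow> nat set list" where
  "thresholds n ms w = map (\<lambda>m. {s\<in>{1..n}. w s \<le> m}) ms"

text \<open>At level \<open>m\<close> the swap is visible only if
  \<open>w s \<le> m < w (left_site n s)\<close>; this pattern forces the swap, which is then a left
  jump.\<close>

lemma thresholds_bell:
  assumes "s \<in> {1..n}"
  shows "thresholds n ms (bell n s w) = map (jump_left n s) (thresholds n ms w)"
proof -
  have "{t\<in>{1..n}. bell n s w t \<le> m} = jump_left n s {t\<in>{1..n}. w t \<le> m}" for m
    using assms left_site_in[OF assms]
    by (auto simp: bell_def jump_left_def Transposition.transpose_def)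
  then show ?thesis by (simp add: thresholds_def)
qed

lemma thresholds_in_set_lists:
  assumes w: "w \<in> tasep_states n" and ms: "\<And>m. m \<in> set ms \<Longrightarrow> m \<le> n"
  shows "thresholds n ms w \<in> set_lists n ms"
proof -
  have perm: "w permutes {1..n}" using w by (simp add: tasep_states_def)
  have "card {s\<in>{1..n}. w s \<le> m} = m" if "m \<le> n" for m
  proof -
    have "w ` {s\<in>{1..n}. w s \<le> m} = w ` {1..n} \<inter> {..m}" by auto
    also have "\<dots> = {1..m}" using permutes_image[OF perm] that by auto
    finally have "card (w ` {s\<in>{1..n}. w s \<le> m}) = m" by simp
    then show ?thesis using permutes_inj[OF perm] by (metis card_image inj_on_subset subset_UNIV)
  qed
  then have "map card (thresholds n ms w) = ms"
    using ms by (simp add: thresholds_def map_idI)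
  moreover have "set (thresholds n ms w) \<subseteq> Pow {1..n}" by (auto simp: thresholds_def)
  ultimately show ?thesis by (simp only: set_lists_def mem_Collect_eq simp_thms)
qed

text \<open>The difference \<open>d\<close> of the two laws on lists is an invariant signed weight
  of total 0, so it vanishes by the uniqueness argument.\<close>

lemma stationary_thresholds_eq:
  fixes f :: "nat set list \<Rightarrow> real"
  assumes st: "tasep_stationary n p" and ms: "\<And>m. m \<in> set ms \<Longrightarrow> m \<le> n"
    and \<Omega>: "finite \<Omega>" "\<Omega> \<noteq> {}" and ring: "ring_stationary n \<Omega> Y"
    and Y: "\<And>\<omega>. \<omega> \<in> \<Omega> \<Longrightarrow> Y \<omega> \<in> set_lists n ms"
  shows "(\<Sum>w\<in>tasep_states n. pmf p w * f (thresholds n ms w)) = (\<Sum>\<omega>\<in>\<Omega>. f (Y \<omega>)) / card \<Omega>"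
proof -
  let ?S = "tasep_states n" and ?X = "set_lists n ms" and ?T = "thresholds n ms"
  define d where "d L = (\<Sum>w\<in>{w\<in>?S. ?T w = L}. pmf p w) - (\<Sum>\<omega>\<in>{\<omega>\<in>\<Omega>. Y \<omega> = L}. 1 / card \<Omega>)" for L
  have T: "?T w \<in> ?X" if "w \<in> ?S" for w using thresholds_in_set_lists that ms by blast
  have d_sum: "(\<Sum>L\<in>?X. d L * g L) = (\<Sum>w\<in>?S. pmf p w * g (?T w)) - (\<Sum>\<omega>\<in>\<Omega>. g (Y \<omega>)) / card \<Omega>" for g
  proof -
    have "(\<Sum>L\<in>?X. d L * g L) = (\<Sum>L\<in>?X. (\<Sum>w\<in>{w\<in>?S. ?T w = L}. pmf p w) * g L)
        - (\<Sum>L\<in>?X. (\<Sum>\<omega>\<in>{\<omega>\<in>\<Omega>. Y \<omega> = L}. 1 / card \<Omega>) * g L)"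
      unfolding d_def left_diff_distrib sum_subtractf ..
    also have "(\<Sum>L\<in>?X. (\<Sum>w\<in>{w\<in>?S. ?T w = L}. pmf p w) * g L) = (\<Sum>w\<in>?S. pmf p w * g (?T w))"
      using finite_tasep_states finite_set_lists T by (rule sum_pushforward)
    also have "(\<Sum>L\<in>?X. (\<Sum>\<omega>\<in>{\<omega>\<in>\<Omega>. Y \<omega> = L}. 1 / card \<Omega>) * g L) = (\<Sum>\<omega>\<in>\<Omega>. 1 / card \<Omega> * g (Y \<omega>))"
      using \<Omega>(1) finite_set_lists Y by (rule sum_pushforward)
    finally show ?thesis by (simp add: sum_divide_distrib)
  qed
  have inv: "(\<Sum>s\<in>{1..n}. \<Sum>L\<in>{L\<in>?X. map (jump_left n s) L = v}. d L) = real (card {1..n}) * d v"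
    if v: "v \<in> ?X" for v
  proof -
    let ?f = "\<lambda>L. of_bool (L = v) :: real"
    have ind: "(\<Sum>L\<in>{L\<in>?X. P L}. d L) = (\<Sum>L\<in>?X. d L * of_bool (P L))" for P
      using sum_of_bool_mult_filter[OF finite_set_lists, of P d n ms] by (simp add: mult.commute)
    have "(\<Sum>s\<in>{1..n}. \<Sum>L\<in>{L\<in>?X. map (jump_left n s) L = v}. d L)
        = (\<Sum>s\<in>{1..n}. (\<Sum>w\<in>?S. pmf p w * ?f (map (jump_left n s) (?T w)))
            - (\<Sum>\<omega>\<in>\<Omega>. ?f (map (jump_left n s) (Y \<omega>))) / card \<Omega>)"
      unfolding ind by (intro sum.cong refl d_sum)
    also have "\<dots> = (\<Sum>w\<in>?S. pmf p w * (\<Sum>s\<in>{1..n}. ?f (map (jump_left n s) (?T w))))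
        - (\<Sum>\<omega>\<in>\<Omega>. \<Sum>s\<in>{1..n}. ?f (map (jump_left n s) (Y \<omega>))) / card \<Omega>"
      unfolding sum_subtractf sum_divide_distrib[symmetric] sum_distrib_left
      by (intro arg_cong2[where f = "(-)"] arg_cong2[where f = "(/)"] refl sum.swap)
    also have "(\<Sum>w\<in>?S. pmf p w * (\<Sum>s\<in>{1..n}. ?f (map (jump_left n s) (?T w))))
        = (\<Sum>w\<in>?S. pmf p w * (\<Sum>s\<in>{1..n}. ?f (?T (bell n s w))))"
      by (intro sum.cong arg_cong2[where f = "(*)"] refl) (simp only: thresholds_bell)
    also have "\<dots> = real n * (\<Sum>w\<in>?S. pmf p w * ?f (?T w))"
      using stationary_bell[OF st, of "\<lambda>w. ?f (?T w)"] .
    also have "(\<Sum>\<omega>\<in>\<Omega>. \<Sum>s\<in>{1..n}. ?f (map (jump_left n s) (Y \<omega>))) = real n * (\<Sum>\<omega>\<in>\<Omega>. ?f (Y \<omega>))"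
      using ring unfolding ring_stationary_def by (rule allE[of _ ?f])
    also have "real n * (\<Sum>w\<in>?S. pmf p w * ?f (?T w)) - real n * (\<Sum>\<omega>\<in>\<Omega>. ?f (Y \<omega>)) / card \<Omega>
        = real n * (\<Sum>L\<in>?X. d L * ?f L)"
      unfolding d_sum by (simp add: right_diff_distrib)
    also have "(\<Sum>L\<in>?X. d L * ?f L) = d v"
      unfolding ind[symmetric] using v by (simp add: conj_commute cong: conj_cong)
    finally show ?thesis by simp
  qed
  have "pmf p w = 0" if "w \<notin> ?S" for w
    using st that unfolding tasep_stationary_def by (meson pmf_eq_0_set_pmf subsetD)
  then have "(\<Sum>w\<in>?S. pmf p w) = 1"
    using st finite_tasep_states unfolding tasep_stationary_def by (intro sum_pmf_eq_1) auto
  then have total: "sum d ?X = 0"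
    using d_sum[of "\<lambda>_. 1"] \<Omega> by simp
  have "map (\<lambda>m. {1..m}) ms \<in> ?X"
    unfolding set_lists_def using ms by (force simp: map_idI)
  then have "d L = 0" if "L \<in> ?X" for L
    using signed_stationary_zero[of ?X "{1..n}" "\<lambda>s. map (jump_left n s)" d "map (\<lambda>m. {1..m}) ms" L]
      finite_set_lists set_lists_jump_left inv set_lists_reach total that by simp
  then show ?thesis using d_sum[of f] by simp
qed

section \<open>Decreasing triples in the three-line queue\<close>

text \<open>For finite sets of positive numbers: \<open>B\<close> has at least \<open>card A\<close>
  elements and, for \<open>k \<le> card A\<close>, its \<open>k\<close>-th largest is at least the
  \<open>k\<close>-th largest of \<open>A\<close>. In queue terms, every stretch ending at the last
  site has at least as many services as arrivals.\<close>

definition dominated :: "nat set \<Rightarrow> nat set \<Rightarrow> bool" where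
  "dominated A B \<longleftrightarrow> (\<forall>y. card {x\<in>A. y < x} \<le> card {x\<in>B. y < x})"

lemma ring_height_backward:
  assumes S: "S \<subseteq> {1..n}" and m: "m \<le> n"
  shows "ring_height n S (- int m) = - int (card {x\<in>S. n - m < x})"
proof -
  have S': "finite S" using S finite_subset by blast
  show ?thesis
    using m
  proof (induction m)
    case 0
    have "{x\<in>S. n - 0 < x} = {}" using S by auto
    then show ?case by (simp only: of_nat_0 minus_zero ring_height_0 card.empty)
  next
    case (Suc m)
    have t: "n - m \<in> {1..n}" using Suc.prems by simp
    have "site n (- int m) = site n (int (n - m) + int n * (- 1))"
      using Suc.prems by (simp add: of_nat_diff)
    then have site: "site n (- int m) = n - m" unfolding site_add site_int[OF t] .
    have "{x\<in>S. n - Suc m < x} = (if n - m \<in> S then insert (n - m) {x\<in>S. n - m < x} else {x\<in>S. n - m < x})"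
      using Suc.prems by (auto simp: not_less less_Suc_eq_le) (metis Suc_diff_Suc Suc_le_eq le_antisym not_le_imp_less)+
    then have "card {x\<in>S. n - Suc m < x} = card {x\<in>S. n - m < x} + of_bool (n - m \<in> S)"
      using S' by simp
    moreover have "ring_height n S (- int (Suc m)) = ring_height n S (- int m) - of_bool (n - m \<in> S)"
    proof -
      have pred: "- int (Suc m) = - int m - 1" by simp
      show ?thesis unfolding pred using ring_height_step[of n S "- int m"] unfolding site by linarith
    qed
    ultimately show ?case using Suc by simp
  qed
qed

text \<open>The left side says that no customer is waiting on the passage from site \<open>n\<close>
  to site 1. Stretches longer than a turn impose nothing new, as each full turn has at least as many
  services as arrivals.\<close>

lemma ring_height_backward_le_iff:
  assumes n: "n \<ge> 1" and S: "S \<subseteq> {1..n}" and D: "D \<subseteq> {1..n}" and le: "card S \<le> card D"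
  shows "(\<forall>y\<le>0. ring_height n D y \<le> ring_height n S y) \<longleftrightarrow> dominated S D"
proof
  assume H: "\<forall>y\<le>0. ring_height n D y \<le> ring_height n S y"
  show "dominated S D"
    unfolding dominated_def
  proof
    fix y
    show "card {x\<in>S. y < x} \<le> card {x\<in>D. y < x}"
    proof (cases "y \<le> n")
      case True
      then show ?thesis
        using H[rule_format, of "- int (n - y)"] ring_height_backward[OF S, of "n - y"]
          ring_height_backward[OF D, of "n - y"] by simp
    next
      case False
      then have "{x\<in>S. y < x} = {}" using S by auto
      then show ?thesis by (simp only: card.empty)
    qed
  qed
next
  assume dom: "dominated S D"
  show "\<forall>y\<le>0. ring_height n D y \<le> ring_height n S y"
  proof (intro allI impI)
    fix y :: int assume y: "y \<le> 0"
    define k where "k = (- y) div int n"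
    define m where "m = nat ((- y) mod int n)"
    have "k \<ge> 0" using y n by (simp add: k_def pos_imp_zdiv_nonneg_iff)
    have "0 \<le> (- y) mod int n" "(- y) mod int n < int n" using n by simp_all
    then have m: "int m = (- y) mod int n" "m \<le> n" by (simp_all add: m_def)
    have y: "y = - int m + int n * (- k)"
      using mult_div_mod_eq[of "int n" "- y"] unfolding m(1) k_def mult_minus_right by linarith
    have "card {x\<in>S. n - m < x} \<le> card {x\<in>D. n - m < x}" using dom by (simp add: dominated_def)
    moreover have "k * int (card S) \<le> k * int (card D)" using \<open>k \<ge> 0\<close> le by (intro mult_left_mono) auto
    ultimately show "ring_height n D y \<le> ring_height n S y"
      unfolding y is_height_period[OF is_height_ring_height S] is_height_period[OF is_height_ring_height D]
        ring_height_backward[OF S m(2)] ring_height_backward[OF D m(2)] by simp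
  qed
qed

lemma ring_height_mono_diff:
  assumes "S \<subseteq> D" "y \<le> x"
  shows "ring_height n S x - ring_height n S y \<le> ring_height n D x - ring_height n D y"
  using assms(2)
proof (induction x rule: int_ge_induct)
  case (step i)
  then show ?case
    using ring_height_step[of n S "i + 1"] ring_height_step[of n D "i + 1"] assms(1) by (auto simp: of_bool_def)
qed simp

lemma ring_height_1_2_3:
  assumes n: "n \<ge> 3"
  shows "ring_height n S 1 = of_bool (1 \<in> S)"
    "ring_height n S 2 = of_bool (1 \<in> S) + of_bool (2 \<in> S)"
    "ring_height n S 3 = of_bool (1 \<in> S) + of_bool (2 \<in> S) + of_bool (3 \<in> S)"
proof -
  have "site n 1 = 1" "site n 2 = 2" "site n 3 = 3"
    using site_int[of 1 n] site_int[of 2 n] site_int[of 3 n] n by simp_all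
  then show "ring_height n S 1 = of_bool (1 \<in> S)"
    "ring_height n S 2 = of_bool (1 \<in> S) + of_bool (2 \<in> S)"
    "ring_height n S 3 = of_bool (1 \<in> S) + of_bool (2 \<in> S) + of_bool (3 \<in> S)"
    using ring_height_step[of n S 1] ring_height_step[of n S 2] ring_height_step[of n S 3] ring_height_0[of n S] by simp_all
qed

lemma all_le_2: "(\<forall>y\<le>2. P y) \<longleftrightarrow> (\<forall>y\<le>0. P y) \<and> P 1 \<and> P (2 :: int)"
proof -
  have "y \<le> 2 \<longleftrightarrow> y \<le> 0 \<or> y = 1 \<or> y = 2" for y :: int by auto
  then show ?thesis by auto
qed

lemma all_le_1: "(\<forall>y\<le>1. P y) \<longleftrightarrow> (\<forall>y\<le>0. P y) \<and> P (1 :: int)"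
proof -
  have "y \<le> 1 \<longleftrightarrow> y \<le> 0 \<or> y = 1" for y :: int by auto
  then show ?thesis by auto
qed

lemma departures_site_2:
  assumes n: "n \<ge> 3" and S: "S \<subseteq> {1..n}" and D: "D \<subseteq> {1..n}" and le: "card S \<le> card D"
    and pat: "1 \<notin> D" "2 \<in> D"
  shows "2 \<notin> departures n S D \<longleftrightarrow> 1 \<notin> S \<and> 2 \<notin> S \<and> dominated S D"
proof -
  have n1: "n \<ge> 1" using n by simp
  have "2 \<notin> departures n S D \<longleftrightarrow> (\<forall>y\<le>1. ring_height n S 2 - ring_height n D 1 \<le> ring_height n S y - ring_height n D y)"
    using departures_iff[OF n1 S D is_height_ring_height is_height_ring_height, of 2] site_int[of 2 n] n pat
    by (auto simp: not_less)
  also have "\<dots> \<longleftrightarrow> 1 \<notin> S \<and> 2 \<notin> S \<and> (\<forall>y\<le>0. ring_height n D y \<le> ring_height n S y)"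
    unfolding all_le_1 ring_height_1_2_3[OF n] using pat ring_height_0[of n S] ring_height_0[of n D]
    by (auto simp: of_bool_def split: if_splits)
  finally show ?thesis unfolding ring_height_backward_le_iff[OF n1 S D le] .
qed

text \<open>Nothing of \<open>S\<close> waits after site 2, hence nothing of the smaller
  \<open>U\<close> either, and the service at 3 can only be used by an arrival at 3 itself.\<close>

lemma departures_site_3_outer:
  assumes n: "n \<ge> 3" and S: "S \<subseteq> {1..n}" and D: "D \<subseteq> {1..n}" and le: "card S \<le> card D"
    and pat: "1 \<notin> D" "2 \<in> D" "1 \<notin> S" "2 \<notin> S" and dom: "dominated S D" and U: "U \<subseteq> S"
  shows "3 \<in> departures n U D \<longleftrightarrow> 3 \<in> D \<and> 3 \<in> U"
proof -
  have n1: "n \<ge> 1" using n by simp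
  have U': "U \<subseteq> {1..n}" "1 \<notin> U" "2 \<notin> U" using U S pat by auto
  have dep: "3 \<notin> departures n U D \<longleftrightarrow>
      3 \<notin> D \<or> (\<forall>y\<le>2. ring_height n U 3 - ring_height n D 2 \<le> ring_height n U y - ring_height n D y)"
    using departures_iff[OF n1 U'(1) D is_height_ring_height is_height_ring_height, of 3] site_int[of 3 n] n
    by (auto simp: not_less)
  have below: "\<forall>y\<le>0. ring_height n D y \<le> ring_height n S y"
    using ring_height_backward_le_iff[OF n1 S D le] dom by blast
  have "ring_height n D y \<le> ring_height n U y" if "y \<le> 0" for y
    using below[rule_format, OF that] ring_height_mono_diff[OF U that, of n] ring_height_0[of n S] ring_height_0[of n U] by simp
  then have "- 1 \<le> ring_height n U y - ring_height n D y" if "y \<le> 0" for y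
    using that by (smt (verit))
  then show ?thesis
    using dep unfolding all_le_2 ring_height_1_2_3[OF n] using pat U' by (auto simp: of_bool_def split: if_splits)
qed

lemma departures_site_3_inner:
  assumes n: "n \<ge> 3" and S: "S \<subseteq> {1..n}" and D: "D \<subseteq> {1..n}" and le: "card S \<le> card D"
    and pat: "1 \<notin> D" "2 \<notin> D"
  shows "3 \<in> departures n S D \<longleftrightarrow> 3 \<in> D \<and> \<not> (1 \<notin> S \<and> 2 \<notin> S \<and> 3 \<notin> S \<and> dominated S D)"
proof -
  have n1: "n \<ge> 1" using n by simp
  have "3 \<in> departures n S D \<longleftrightarrow>
      3 \<in> D \<and> \<not> (\<forall>y\<le>2. ring_height n S 3 - ring_height n D 2 \<le> ring_height n S y - ring_height n D y)"
    using departures_iff[OF n1 S D is_height_ring_height is_height_ring_height, of 3] site_int[of 3 n] n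
    by (auto simp: not_less)
  also have "(\<forall>y\<le>2. ring_height n S 3 - ring_height n D 2 \<le> ring_height n S y - ring_height n D y)
      \<longleftrightarrow> 1 \<notin> S \<and> 2 \<notin> S \<and> 3 \<notin> S \<and> (\<forall>y\<le>0. ring_height n D y \<le> ring_height n S y)"
    unfolding all_le_2 ring_height_1_2_3[OF n] using pat ring_height_0[of n S] ring_height_0[of n D]
    by (auto simp: of_bool_def split: if_splits)
  finally show ?thesis unfolding ring_height_backward_le_iff[OF n1 S D le] .
qed

text \<open>Among the first three sites \<open>S\<close> can only contain 3, and then so does
  \<open>D\<close>; hence stretches that reach below 4 add no condition.\<close>

lemma dominated_restrict:
  assumes n: "n \<ge> 3" and S: "S \<subseteq> {1..n}" and D: "D \<subseteq> {1..n}" and pat: "1 \<notin> S" "2 \<notin> S" "3 \<in> S \<Longrightarrow> 3 \<in> D"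
  shows "dominated S D \<longleftrightarrow> dominated (S \<inter> {4..n}) (D \<inter> {4..n})"
proof -
  have fin: "finite S" "finite D" using S D finite_subset by blast+
  have restrict: "{x\<in>A \<inter> {4..n}. y < x} = {x\<in>A. max 3 y < x}" if "A \<subseteq> {1..n}" for A y
    using that by auto
  have S_split: "{x\<in>S. y < x} = {x\<in>S. 3 < x} \<union> (if 3 \<in> S then {3} else {})" if "y < 3" for y
  proof -
    have "x = 3 \<or> 3 < x" if "x \<in> S" for x
    proof -
      have "x \<noteq> 0" "x \<noteq> 1" "x \<noteq> 2" using that pat S by auto
      then show ?thesis by linarith
    qed
    then show ?thesis using that by auto
  qed
  have D_sup: "{x\<in>D. 3 < x} \<union> (if 3 \<in> S then {3} else {}) \<subseteq> {x\<in>D. y < x}" if "y < 3" for y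
    using that pat(3) by auto
  have "card {x\<in>S. y < x} \<le> card {x\<in>D. y < x}"
    if H: "\<And>y. card {x\<in>S. max 3 y < x} \<le> card {x\<in>D. max 3 y < x}" for y
  proof (cases "y < 3")
    case True
    have "card {x\<in>S. y < x} = card {x\<in>S. 3 < x} + of_bool (3 \<in> S)"
      unfolding S_split[OF True] using fin by (auto simp: card_Un_disjoint)
    also have "\<dots> \<le> card {x\<in>D. 3 < x} + of_bool (3 \<in> S)" using H[of 3] by simp
    also have "\<dots> = card ({x\<in>D. 3 < x} \<union> (if 3 \<in> S then {3} else {}))"
      using fin by (auto simp: card_Un_disjoint)
    also have "\<dots> \<le> card {x\<in>D. y < x}" using D_sup[OF True] fin by (intro card_mono) auto
    finally show ?thesis .
  next
    case False
    then show ?thesis using H[of y] by (simp add: max_def split: if_splits)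
  qed
  then show ?thesis unfolding dominated_def restrict[OF S] restrict[OF D] by blast
qed

lemma decreasing_event_iff:
  assumes n: "n \<ge> 3" and A: "A \<subseteq> {1..n}" and B: "B \<subseteq> {1..n}" and C: "C \<subseteq> {1..n}"
    and le: "card A \<le> card B" "card B \<le> card C"
  shows "1 \<notin> C \<and> 2 \<in> C \<and> 2 \<notin> departures n B C \<and> 3 \<in> departures n (departures n A B) C \<longleftrightarrow>
    C \<inter> {1..3} = {2, 3} \<and> B \<inter> {1..3} = {3} \<and> dominated (B \<inter> {4..n}) (C \<inter> {4..n}) \<and>
    \<not> (A \<inter> {1..3} = {} \<and> dominated (A \<inter> {4..n}) (B \<inter> {4..n}))"
proof -
  have three: "{1..3} = {1, 2, 3 :: nat}" by auto
  have pats: "C \<inter> {1..3} = {2, 3} \<longleftrightarrow> 1 \<notin> C \<and> 2 \<in> C \<and> 3 \<in> C"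
    "B \<inter> {1..3} = {3} \<longleftrightarrow> 1 \<notin> B \<and> 2 \<notin> B \<and> 3 \<in> B"
    "A \<inter> {1..3} = {} \<longleftrightarrow> 1 \<notin> A \<and> 2 \<notin> A \<and> 3 \<notin> A"
  proof -
    have "X \<inter> {1..3} = Y \<longleftrightarrow> (1 \<in> X \<longleftrightarrow> 1 \<in> Y) \<and> (2 \<in> X \<longleftrightarrow> 2 \<in> Y) \<and> (3 \<in> X \<longleftrightarrow> 3 \<in> Y)"
      if "Y \<subseteq> {1, 2, 3}" for X Y :: "nat set"
      unfolding three using that by blast
    from this[of "{2, 3}" C] this[of "{3}" B] this[of "{}" A]
    show "C \<inter> {1..3} = {2, 3} \<longleftrightarrow> 1 \<notin> C \<and> 2 \<in> C \<and> 3 \<in> C"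
      "B \<inter> {1..3} = {3} \<longleftrightarrow> 1 \<notin> B \<and> 2 \<notin> B \<and> 3 \<in> B"
      "A \<inter> {1..3} = {} \<longleftrightarrow> 1 \<notin> A \<and> 2 \<notin> A \<and> 3 \<notin> A" by simp_all
  qed
  show ?thesis
  proof (cases "1 \<notin> C \<and> 2 \<in> C \<and> 1 \<notin> B \<and> 2 \<notin> B \<and> dominated B C")
    case True
    then have "3 \<in> departures n (departures n A B) C \<longleftrightarrow> 3 \<in> C \<and> 3 \<in> departures n A B"
      using departures_subset by (intro departures_site_3_outer[OF n B C le(2)]) auto
    moreover have "3 \<in> departures n A B \<longleftrightarrow> 3 \<in> B \<and> \<not> (1 \<notin> A \<and> 2 \<notin> A \<and> 3 \<notin> A \<and> dominated A B)"
      using True by (intro departures_site_3_inner[OF n A B le(1)]) auto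
    moreover have "2 \<notin> departures n B C"
      using True departures_site_2[OF n B C le(2)] by blast
    ultimately show ?thesis
      unfolding pats using True dominated_restrict[OF n B C] dominated_restrict[OF n A B] by blast
  next
    case False
    then show ?thesis
      unfolding pats using departures_site_2[OF n B C le(2)] dominated_restrict[OF n B C] by blast
  qed
qed

section \<open>Counting dominated chains\<close>

text \<open>The value 0 at negative arguments makes Pascal's rule hold at every integer.\<close>

definition binom :: "nat \<Rightarrow> int \<Rightarrow> real" where
  "binom K p = (if p < 0 then 0 else real (K choose nat p))"

lemma binom_Suc: "binom (Suc K) p = binom K p + binom K (p - 1)"
proof (cases "p \<ge> 1")
  case True
  then have "nat p = Suc (nat (p - 1))" by simp
  then show ?thesis using True by (simp add: binom_def)
qed (auto simp: binom_def)

text \<open>The determinant with rows \<open>(r, r + 1, r + 2)\<close>,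
  \<open>(q - 1, q, q + 1)\<close>, \<open>(p - 2, p - 1, p)\<close> of lower indices, expanded
  along the first row: the dual Jacobi-Trudi determinant for columns of lengths \<open>r\<close>,
  \<open>q\<close>, \<open>p\<close>, at \<open>K\<close> variables equal to 1.\<close>

definition binom_det :: "nat \<Rightarrow> int \<Rightarrow> int \<Rightarrow> int \<Rightarrow> real" where
  "binom_det K p q r =
     binom K r * (binom K q * binom K p - binom K (q + 1) * binom K (p - 1))
     - binom K (r + 1) * (binom K (q - 1) * binom K p - binom K (q + 1) * binom K (p - 2))
     + binom K (r + 2) * (binom K (q - 1) * binom K (p - 1) - binom K q * binom K (p - 2))"

text \<open>Pascal's rule splits each row into two rows of the same kind, and the determinant is
  linear in each row.\<close>

lemma binom_det_Suc:
  "binom_det (Suc K) p q r = (\<Sum>\<alpha>\<in>{0, 1}. \<Sum>\<beta>\<in>{0, 1}. \<Sum>\<gamma>\<in>{0, 1}. binom_det K (p - \<alpha>) (q - \<beta>) (r - \<gamma>))"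
proof -
  have shifts: "q - 1 + 1 = q" "r - 1 + 1 = r" "r - 1 + 2 = r + 1" "p - 1 - 1 = p - 2" "q + 1 - 1 = q"
    "r + 1 - 1 = r" "p - 1 - 2 = p - 3" "p - 2 - 1 = p - 3" "r + 2 - 1 = r + 1" for p q r :: int by simp_all
  have s: "(\<Sum>x\<in>{0, 1}. f x) = f 0 + f 1" for f :: "int \<Rightarrow> real" by simp
  show ?thesis
    unfolding s binom_det_def binom_Suc diff_0_right shifts by algebra
qed

lemma dominated_card_le:
  assumes "dominated A B" "A \<subseteq> {m<..}" "B \<subseteq> {m<..}" shows "card A \<le> card B"
proof -
  have "{x\<in>A. m < x} = A" "{x\<in>B. m < x} = B" using assms by auto
  then show ?thesis using assms(1) unfolding dominated_def by metis
qed

text \<open>A new minimum is counted only by the thresholds below it, and there the counts are the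
  full cardinalities.\<close>

lemma dominated_insert_min:
  assumes m: "m > 0" and A: "finite A" "A \<subseteq> {m<..}" and B: "finite B" "B \<subseteq> {m<..}"
    and A': "A' = (if \<alpha> then insert m A else A)" and B': "B' = (if \<beta> then insert m B else B)"
  shows "dominated A' B' \<longleftrightarrow> dominated A B \<and> card A + of_bool \<alpha> \<le> card B + of_bool \<beta>"
proof -
  have notin: "m \<notin> A" "m \<notin> B" using A B by auto
  have above: "{x\<in>A'. y < x} = {x\<in>A. y < x}" "{x\<in>B'. y < x} = {x\<in>B. y < x}" if "m \<le> y" for y
    using that A' B' by auto
  have below: "{x\<in>A'. y < x} = A'" "{x\<in>B'. y < x} = B'"
      "{x\<in>A. y < x} = {x\<in>A. m < x}" "{x\<in>B. y < x} = {x\<in>B. m < x}" if "y < m" for y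
    using that A B A' B' by auto
  have card': "card A' = card A + of_bool \<alpha>" "card B' = card B + of_bool \<beta>"
    using A B A' B' notin by simp_all
  show ?thesis
  proof
    assume dom: "dominated A' B'"
    have "card A' \<le> card B'"
      using dom[unfolded dominated_def, rule_format, of "m - 1"] below(1,2)[of "m - 1"] m by simp
    moreover have "card {x\<in>A. y < x} \<le> card {x\<in>B. y < x}" for y
      using dom[unfolded dominated_def, rule_format, of "max m y"] above[of "max m y"] below(3,4)[of y]
      by (cases "m \<le> y") (simp_all add: max_def)
    ultimately show "dominated A B \<and> card A + of_bool \<alpha> \<le> card B + of_bool \<beta>"
      by (simp add: dominated_def card')
  next
    assume H: "dominated A B \<and> card A + of_bool \<alpha> \<le> card B + of_bool \<beta>"
    show "dominated A' B'"
      unfolding dominated_def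
    proof
      fix y
      show "card {x\<in>A'. y < x} \<le> card {x\<in>B'. y < x}"
      proof (cases "m \<le> y")
        case True
        then show ?thesis using H by (simp add: above dominated_def)
      next
        case False
        then show ?thesis using H card' below(1,2)[of y] by simp
      qed
    qed
  qed
qed

lemma sum_Pow_insert:
  fixes g :: "'b set \<Rightarrow> real"
  assumes "finite I" "m \<notin> I"
  shows "(\<Sum>A\<in>Pow (insert m I). g A) = (\<Sum>A\<in>Pow I. g A) + (\<Sum>A\<in>Pow I. g (insert m A))"
proof -
  have "(\<Sum>A\<in>Pow (insert m I). g A) = (\<Sum>A\<in>Pow I. g A) + (\<Sum>A\<in>insert m ` Pow I. g A)"
    unfolding Pow_insert using assms by (intro sum.union_disjoint) auto
  also have "(\<Sum>A\<in>insert m ` Pow I. g A) = (\<Sum>A\<in>Pow I. g (insert m A))"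
    using assms(2) by (subst sum.reindex) (auto simp: inj_on_def)
  finally show ?thesis .
qed

definition chain_count :: "nat set \<Rightarrow> int \<Rightarrow> int \<Rightarrow> int \<Rightarrow> real" where
  "chain_count I p q r = (\<Sum>A\<in>Pow I. \<Sum>B\<in>Pow I. \<Sum>C\<in>Pow I.
     of_bool (int (card A) = p \<and> int (card B) = q \<and> int (card C) = r \<and> dominated A B \<and> dominated B C))"

text \<open>Decide for each set whether it contains \<open>m\<close>. The cardinality conditions
  that this adds to domination follow from \<open>p \<le> q \<le> r\<close>, so all eight terms are
  counts of the same kind.\<close>

lemma chain_count_insert_min:
  assumes m: "m > 0" and I: "finite I" "I \<subseteq> {m<..}" and pqr: "p \<le> q" "q \<le> r"
  shows "chain_count (insert m I) p q r
    = (\<Sum>\<alpha>\<in>{0, 1}. \<Sum>\<beta>\<in>{0, 1}. \<Sum>\<gamma>\<in>{0, 1}. chain_count I (p - \<alpha>) (q - \<beta>) (r - \<gamma>))"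
proof -
  let ?e = "\<lambda>\<alpha> A. if \<alpha> then insert m A else A"
  let ?P = "\<lambda>A B C p q r. int (card A) = p \<and> int (card B) = q \<and> int (card C) = r \<and> dominated A B \<and> dominated B C"
  have mI: "m \<notin> I" using I by auto
  have ins: "?P (?e \<alpha> A) (?e \<beta> B) (?e \<gamma> C) p q r
      = ?P A B C (p - of_bool \<alpha>) (q - of_bool \<beta>) (r - of_bool \<gamma>)"
    if "A \<in> Pow I" "B \<in> Pow I" "C \<in> Pow I" for \<alpha> \<beta> \<gamma> A B C
  proof -
    have sub: "A \<subseteq> {m<..}" "B \<subseteq> {m<..}" "C \<subseteq> {m<..}" "finite A" "finite B" "finite C"
      using that I finite_subset by auto
    have card: "card (?e \<delta> X) = card X + of_bool \<delta>" if "X \<in> Pow I" for \<delta> X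
    proof -
      have "finite X" "m \<notin> X" using that I mI finite_subset by auto
      then show ?thesis by simp
    qed
    show ?thesis
      unfolding dominated_insert_min[OF m sub(4,1,5,2) refl refl]
        dominated_insert_min[OF m sub(5,2,6,3) refl refl] card[OF that(1)] card[OF that(2)] card[OF that(3)]
      using pqr by (cases \<alpha>; cases \<beta>; cases \<gamma>) auto
  qed
  have part: "(\<Sum>A\<in>Pow I. \<Sum>B\<in>Pow I. \<Sum>C\<in>Pow I. of_bool (?P (?e \<alpha> A) (?e \<beta> B) (?e \<gamma> C) p q r))
      = chain_count I (p - of_bool \<alpha>) (q - of_bool \<beta>) (r - of_bool \<gamma>)" for \<alpha> \<beta> \<gamma>
    unfolding chain_count_def by (intro sum.cong refl arg_cong[where f = of_bool]) (rule ins)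
  have "chain_count (insert m I) p q r = (\<Sum>\<alpha>\<in>{False, True}. \<Sum>\<beta>\<in>{False, True}. \<Sum>\<gamma>\<in>{False, True}.
      (\<Sum>A\<in>Pow I. \<Sum>B\<in>Pow I. \<Sum>C\<in>Pow I. of_bool (?P (?e \<alpha> A) (?e \<beta> B) (?e \<gamma> C) p q r)))"
    unfolding chain_count_def sum_Pow_insert[OF I(1) mI] sum.distrib by simp
  also have "\<dots> = (\<Sum>\<alpha>\<in>{0, 1}. \<Sum>\<beta>\<in>{0, 1}. \<Sum>\<gamma>\<in>{0, 1}. chain_count I (p - \<alpha>) (q - \<beta>) (r - \<gamma>))"
    unfolding part by simp
  finally show ?thesis .
qed

lemma chain_count_eq_0:
  assumes "I \<subseteq> {m<..}" "q < p \<or> r < q"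
  shows "chain_count I p q r = 0"
proof -
  have "\<not> (int (card A) = p \<and> int (card B) = q \<and> int (card C) = r \<and> dominated A B \<and> dominated B C)"
    if "A \<in> Pow I" "B \<in> Pow I" "C \<in> Pow I" for A B C
    using dominated_card_le[of A B m] dominated_card_le[of B C m] assms that by force
  then show ?thesis
    unfolding chain_count_def by (intro sum.neutral ballI) (simp only: of_bool_def if_False)
qed

lemma binom_0: "binom 0 p = of_bool (p = 0)"
  by (auto simp: binom_def)

text \<open>The hypotheses reach one step beyond the cone \<open>p \<le> q \<le> r\<close>, onto the walls where both sides
  vanish; this is what makes the recursion of the determinant match that of the count.\<close>

lemma chain_count_eq_binom_det:
  assumes "K < n" "p \<le> q + 1" "q \<le> r + 1"
  shows "chain_count {n - K<..n} p q r = binom_det K p q r"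
  using assms
proof (induction K arbitrary: p q r)
  case 0
  have "dominated {} {}" by (simp add: dominated_def)
  then have "chain_count {n - 0<..n} p q r = of_bool (p = 0 \<and> q = 0 \<and> r = 0)"
    by (auto simp: chain_count_def)
  then show ?case using 0 by (auto simp: binom_det_def binom_0)
next
  case (Suc K)
  have I: "{n - Suc K<..n} = insert (n - K) {n - K<..n}" using Suc.prems(1) by auto
  have sub: "{n - K<..n} \<subseteq> {n - K<..}" "{n - Suc K<..n} \<subseteq> {n - Suc K<..}" by auto
  consider "p \<le> q" "q \<le> r" | "p = q + 1" | "q = r + 1" using Suc.prems by linarith
  then show ?case
  proof cases
    case 1
    have "chain_count {n - Suc K<..n} p q r
      = (\<Sum>\<alpha>\<in>{0, 1}. \<Sum>\<beta>\<in>{0, 1}. \<Sum>\<gamma>\<in>{0, 1}. chain_count {n - K<..n} (p - \<alpha>) (q - \<beta>) (r - \<gamma>))"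
      unfolding I using Suc.prems(1) by (intro chain_count_insert_min 1 sub) auto
    also have "\<dots> = (\<Sum>\<alpha>\<in>{0, 1}. \<Sum>\<beta>\<in>{0, 1}. \<Sum>\<gamma>\<in>{0, 1}. binom_det K (p - \<alpha>) (q - \<beta>) (r - \<gamma>))"
      using 1 Suc.prems(1) by (intro sum.cong refl Suc.IH) auto
    finally show ?thesis unfolding binom_det_Suc .
  next
    case 2
    then have "chain_count {n - Suc K<..n} p q r = 0" by (intro chain_count_eq_0[OF sub(2)]) auto
    \<comment> \<open>Two rows of the determinant coincide; likewise in the next case.\<close>
    moreover have "binom_det (Suc K) p q r = 0" using 2 by (simp add: binom_det_def algebra_simps)
    ultimately show ?thesis by simp
  next
    case 3
    then have "chain_count {n - Suc K<..n} p q r = 0" by (intro chain_count_eq_0[OF sub(2)]) auto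
    moreover have "binom_det (Suc K) p q r = 0" using 3 by (simp add: binom_det_def algebra_simps)
    ultimately show ?thesis by simp
  qed
qed

section \<open>Evaluation of the determinant as a rational function\<close>

lemma binom_absorb:
  assumes "n \<ge> 1"
  shows "real n * binom (n - 1) p = (real n - of_int p) * binom n p"
    and "real n * binom (n - 1) (p - 1) = of_int p * binom n p"
proof -
  obtain m where n: "n = Suc m" using assms by (cases n) auto
  show "real n * binom (n - 1) p = (real n - of_int p) * binom n p"
  proof (cases "0 \<le> p \<and> p \<le> int n")
    case True
    then obtain k where p: "p = int k" "k \<le> n" by (metis nonneg_int_cases of_nat_le_iff)
    have "real ((n - k) * (n choose k)) = real (n * (n - 1 choose k))"
      by (simp only: binomial_absorb_comp)
    then show ?thesis using p by (simp add: binom_def of_nat_diff)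
  next
    case False
    then have "nat p > n" if "\<not> p < 0" using that by auto
    then show ?thesis by (cases "p < 0") (auto simp: binom_def binomial_eq_0)
  qed
  show "real n * binom (n - 1) (p - 1) = of_int p * binom n p"
  proof (cases "p \<ge> 1")
    case True
    define k where "k = nat p - 1"
    have p: "p = int (Suc k)" using True by (simp add: k_def)
    have "real (Suc k * (n choose Suc k)) = real (n * (n - 1 choose k))"
      using Suc_times_binomial_eq[of m k] by (simp only: n diff_Suc_1 mult.commute)
    moreover have "binom n (int (Suc k)) = real (n choose Suc k)"
      by (simp add: binom_def del: of_nat_Suc)
    moreover have "binom (n - 1) (int (Suc k) - 1) = real (n - 1 choose k)"
      by (simp add: binom_def)
    ultimately show ?thesis unfolding p by (simp only: of_nat_mult of_int_of_nat_eq)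
  next
    case False
    then show ?thesis by (cases "p = 0") (auto simp: binom_def)
  qed
qed

text \<open>Divided by \<open>n choose x\<close>, the three numbers are the probabilities that a
  uniform \<open>x\<close>-subset of \<open>n\<close> sites shows a prescribed pattern with 0, 1 or
  2 particles on three given sites.\<close>

lemma binom_minus_3:
  assumes n: "n \<ge> 3"
  defines "N \<equiv> real n * (real n - 1) * (real n - 2)"
  shows "binom (n - 3) (int x) = real (n choose x) * ((real n - x) * (real n - x - 1) * (real n - x - 2) / N)"
    and "binom (n - 3) (int x - 1) = real (n choose x) * (x * (real n - x) * (real n - x - 1) / N)"
    and "binom (n - 3) (int x - 2) = real (n choose x) * (x * (real x - 1) * (real n - x) / N)"
proof -
  have n1: "n - 1 \<ge> 1" "n - 2 \<ge> 1" "n \<ge> 1" "n - 1 - 1 = n - 2" "n - 2 - 1 = n - 3" using n by auto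
  have r: "real (n - 1) = real n - 1" "real (n - 2) = real n - 2" using n by auto
  have N: "N \<noteq> 0" using n by (auto simp: N_def)
  have b: "binom n (int x) = real (n choose x)" by (simp add: binom_def)
  note a1 = binom_absorb[OF n1(3)] and a2 = binom_absorb[OF n1(1), unfolded n1 r]
    and a3 = binom_absorb[OF n1(2), unfolded n1 r]
  have "N * binom (n - 3) (int x) = binom n (int x) * ((real n - x) * (real n - x - 1) * (real n - x - 2))"
  proof -
    have "N * binom (n - 3) (int x) = real n * (real n - 1) * ((real n - 2) * binom (n - 3) (int x))"
      by (simp add: N_def)
    also have "\<dots> = real n * ((real n - 1) * binom (n - 2) (int x)) * (real n - 2 - x)"
      by (simp add: a3(1))
    also have "\<dots> = (real n * binom (n - 1) (int x)) * (real n - 1 - x) * (real n - 2 - x)"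
      by (simp add: a2(1))
    finally show ?thesis unfolding a1(1) of_int_of_nat_eq by algebra
  qed
  then show "binom (n - 3) (int x) = real (n choose x) * ((real n - x) * (real n - x - 1) * (real n - x - 2) / N)"
    using N b by (simp add: field_simps)
  have "N * binom (n - 3) (int x - 1) = binom n (int x) * (x * (real n - x) * (real n - x - 1))"
  proof -
    have "N * binom (n - 3) (int x - 1) = real n * (real n - 1) * ((real n - 2) * binom (n - 3) (int x - 1))"
      by (simp add: N_def)
    also have "\<dots> = real n * ((real n - 1) * binom (n - 2) (int x - 1)) * (real n - x - 1)"
      by (simp add: a3(1))
    also have "\<dots> = (real n * binom (n - 1) (int x - 1)) * (real n - x) * (real n - x - 1)"
      by (simp add: a2(1))
    finally show ?thesis unfolding a1(2) of_int_of_nat_eq by algebra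
  qed
  then show "binom (n - 3) (int x - 1) = real (n choose x) * (x * (real n - x) * (real n - x - 1) / N)"
    using N b by (simp add: field_simps)
  have "N * binom (n - 3) (int x - 2) = binom n (int x) * (x * (real x - 1) * (real n - x))"
  proof -
    have "N * binom (n - 3) (int x - 2) = real n * (real n - 1) * ((real n - 2) * binom (n - 3) (int x - 2))"
      by (simp add: N_def)
    also have "\<dots> = real n * ((real n - 1) * binom (n - 2) (int x - 1 - 1)) * (real n - x)"
      by (simp add: a3(1))
    also have "\<dots> = (real n * binom (n - 1) (int x - 1)) * (real x - 1) * (real n - x)"
      by (simp only: a2(2)) simp
    finally show ?thesis unfolding a1(2) of_int_of_nat_eq by algebra
  qed
  then show "binom (n - 3) (int x - 2) = real (n choose x) * (x * (real x - 1) * (real n - x) / N)"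
    using N b by (simp add: field_simps)
qed

lemma binom_det_ratio:
  assumes n: "n \<ge> 3" and le: "a \<le> n" "b \<le> n" "c \<le> n"
  shows "(real (n choose a) * binom_det (n - 3) 0 (int b - 1) (int c - 2)
        - binom_det (n - 3) (int a) (int b - 1) (int c - 2))
      / (real (n choose a) * real (n choose b) * real (n choose c))
    = (real n - b) * (real n - c) * (real c - b)
        * (real n * b * c - (real n - a) * (real c - a) * (real b - a))
      / (real n ^ 3 * (real n - 1) ^ 2 * (real n - 2))"
proof -
  define N where "N = real n * (real n - 1) * (real n - 2)"
  have N: "N \<noteq> 0" using n by (auto simp: N_def)
  define h0 where "h0 x = (real n - x) * (real n - x - 1) * (real n - x - 2)" for x
  define h1 where "h1 x = x * (real n - x) * (real n - x - 1)" for x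
  define h2 where "h2 x = x * (x - 1) * (real n - x)" for x
  define g0 where "g0 x = h0 x / N" for x
  define g1 where "g1 x = h1 x / N" for x
  define g2 where "g2 x = h2 x / N" for x
  have pos: "real (n choose a) \<noteq> 0" "real (n choose b) \<noteq> 0" "real (n choose c) \<noteq> 0"
    using le by auto
  have bin: "binom (n - 3) (int x) = real (n choose x) * g0 x" "binom (n - 3) (int x - 1) = real (n choose x) * g1 x"
    "binom (n - 3) (int x - 2) = real (n choose x) * g2 x" for x
    using binom_minus_3[OF n] unfolding g0_def g1_def g2_def h0_def h1_def h2_def N_def by blast+
  have shifts: "int c - 2 + 1 = int c - 1" "int c - 2 + 2 = int c" "int b - 1 + 1 = int b" "int b - 1 - 1 = int b - 2"
    by simp_all
  \<comment> \<open>For \<open>p = 0\<close> the last row is \<open>(0, 0, 1)\<close>, so the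
    determinant collapses to a 2 by 2 minor.\<close>
  have base: "binom (n - 3) 0 = 1" "binom (n - 3) (0 - 1) = 0" "binom (n - 3) (0 - 2) = 0"
    by (simp_all add: binom_def)
  let ?det = "g2 c * (g1 b * g0 a - g0 b * g1 a) - g1 c * (g2 b * g0 a - g0 b * g2 a)
     + g0 c * (g2 b * g1 a - g1 b * g2 a)"
  have "real (n choose a) * binom_det (n - 3) 0 (int b - 1) (int c - 2)
        - binom_det (n - 3) (int a) (int b - 1) (int c - 2)
     = (real (n choose a) * real (n choose b) * real (n choose c)) * (g2 c * g1 b - g1 c * g2 b - ?det)"
    unfolding binom_det_def shifts bin base by (simp add: algebra_simps)
  then have "(real (n choose a) * binom_det (n - 3) 0 (int b - 1) (int c - 2)
        - binom_det (n - 3) (int a) (int b - 1) (int c - 2))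
      / (real (n choose a) * real (n choose b) * real (n choose c)) = g2 c * g1 b - g1 c * g2 b - ?det"
    using pos by simp
  also have "g2 c * g1 b - g1 c * g2 b
      = (real n - b) * (real n - c) * (real c - b) * (b * c) * (real n - 2) / N ^ 2"
  proof -
    have "g2 c * g1 b - g1 c * g2 b = (h2 c * h1 b - h1 c * h2 b) / N ^ 2"
      unfolding g1_def g2_def using N by (simp add: divide_simps) algebra
    also have "h2 c * h1 b - h1 c * h2 b = (real n - b) * (real n - c) * (real c - b) * (b * c) * (real n - 2)"
      unfolding h1_def h2_def of_nat_mult by algebra
    finally show ?thesis .
  qed
  also have "?det = (real n - a) * (real n - b) * (real n - c) * (real c - b) * (real c - a) * (real b - a)
      * (real n - 1) * (real n - 2) ^ 2 / N ^ 3"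
  proof -
    have "?det = (h2 c * (h1 b * h0 a - h0 b * h1 a) - h1 c * (h2 b * h0 a - h0 b * h2 a)
     + h0 c * (h2 b * h1 a - h1 b * h2 a)) / N ^ 3"
      unfolding g0_def g1_def g2_def using N by (simp add: divide_simps) algebra
    \<comment> \<open>Every \<open>h\<close> is \<open>n - x\<close> times a quadratic, so the
      determinant is the product of these linear factors and the Vandermonde product of
      \<open>a\<close>, \<open>b\<close>, \<open>c\<close>, up to the constant
      \<open>(n - 1) * (n - 2) ^ 2\<close>.\<close>
    also have "h2 c * (h1 b * h0 a - h0 b * h1 a) - h1 c * (h2 b * h0 a - h0 b * h2 a)
     + h0 c * (h2 b * h1 a - h1 b * h2 a)
     = (real n - a) * (real n - b) * (real n - c) * (real c - b) * (real c - a) * (real b - a)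
      * (real n - 1) * (real n - 2) ^ 2"
      unfolding h0_def h1_def h2_def by algebra
    finally show ?thesis .
  qed
  also have "(real n - b) * (real n - c) * (real c - b) * (b * c) * (real n - 2) / N ^ 2
      - (real n - a) * (real n - b) * (real n - c) * (real c - b) * (real c - a) * (real b - a)
      * (real n - 1) * (real n - 2) ^ 2 / N ^ 3
    = (real n - b) * (real n - c) * (real c - b)
        * (real n * b * c - (real n - a) * (real c - a) * (real b - a))
      / (real n ^ 3 * (real n - 1) ^ 2 * (real n - 2))"
  proof -
    have scale: "x * w / (u * v * w) ^ 2 - y * v * w ^ 2 / (u * v * w) ^ 3 = (u * x - y) / (u ^ 3 * v ^ 2 * w)"
      if "u \<noteq> 0" "v \<noteq> 0" "w \<noteq> 0" for u v w x y :: real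
      using that by (simp add: divide_simps) algebra
    have "real n * ((real n - b) * (real n - c) * (real c - b) * (real b * real c))
        - (real n - a) * (real n - b) * (real n - c) * (real c - b) * (real c - a) * (real b - a)
      = (real n - b) * (real n - c) * (real c - b)
        * (real n * b * c - (real n - a) * (real c - a) * (real b - a))"
      by algebra
    then show ?thesis
      unfolding N_def of_nat_mult using n by (subst scale) auto
  qed
  finally show ?thesis .
qed

section \<open>The probability of a decreasing triple\<close>

lemma sum_fixed_pattern:
  fixes g :: "nat set \<Rightarrow> real"
  assumes n: "n \<ge> 3" and K: "K \<subseteq> {1..3}"
  shows "(\<Sum>R\<in>{R. R \<subseteq> {1..n} \<and> card R = r}. of_bool (R \<inter> {1..3} = K) * g (R \<inter> {4..n}))
    = (\<Sum>A\<in>Pow {4..n}. of_bool (int (card A) = int r - int (card K)) * g A)"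
proof -
  let ?R = "{R. R \<subseteq> {1..n} \<and> card R = r}"
  have fin: "finite ?R" by (rule finite_subset[of _ "Pow {1..n}"]) auto
  have split: "R = (R \<inter> {1..3}) \<union> (R \<inter> {4..n})" if "R \<subseteq> {1..n}" for R
    using that by force
  have finK: "finite K" using K finite_subset by blast
  have "(\<Sum>R\<in>{R\<in>?R. R \<inter> {1..3} = K}. g (R \<inter> {4..n}))
      = (\<Sum>A\<in>{A\<in>Pow {4..n}. int (card A) = int r - int (card K)}. g A)"
  proof (rule sum.reindex_bij_witness[where j = "\<lambda>R. R \<inter> {4..n}" and i = "\<lambda>A. K \<union> A"])
    fix R assume R: "R \<in> {R\<in>?R. R \<inter> {1..3} = K}"
    then show eq: "K \<union> R \<inter> {4..n} = R" using split[of R] by auto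
    have "card (K \<union> R \<inter> {4..n}) = card K + card (R \<inter> {4..n})"
      using K finK by (intro card_Un_disjoint) auto
    then have "int (card (R \<inter> {4..n})) = int r - int (card K)" using R eq by simp
    then show "R \<inter> {4..n} \<in> {A\<in>Pow {4..n}. int (card A) = int r - int (card K)}" by simp
  next
    fix A assume A: "A \<in> {A\<in>Pow {4..n}. int (card A) = int r - int (card K)}"
    then show eq: "(K \<union> A) \<inter> {4..n} = A" using K by auto
    have "finite A" using A finite_subset[of A "{4..n}"] by auto
    then have "card (K \<union> A) = card K + card A"
      using K finK A by (intro card_Un_disjoint) force+
    then have "card (K \<union> A) = r" using A by auto
    moreover have "K \<union> A \<subseteq> {1..n}" "(K \<union> A) \<inter> {1..3} = K" using K A n by force+
    ultimately show "K \<union> A \<in> {R\<in>?R. R \<inter> {1..3} = K}" by simp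
  qed auto
  then show ?thesis
    unfolding sum_of_bool_mult_filter[OF fin]
    by (subst sum_of_bool_mult_filter) simp_all
qed

lemma sum_fixed_patterns:
  fixes h :: "nat set \<Rightarrow> nat set \<Rightarrow> nat set \<Rightarrow> real"
  assumes n: "n \<ge> 3" and K: "K1 \<subseteq> {1..3}" "K2 \<subseteq> {1..3}" "K3 \<subseteq> {1..3}"
  shows "(\<Sum>A\<in>{R. R \<subseteq> {1..n} \<and> card R = a}. \<Sum>B\<in>{R. R \<subseteq> {1..n} \<and> card R = b}.
      \<Sum>C\<in>{R. R \<subseteq> {1..n} \<and> card R = c}.
        of_bool (A \<inter> {1..3} = K1) * (of_bool (B \<inter> {1..3} = K2) * (of_bool (C \<inter> {1..3} = K3)
          * h (A \<inter> {4..n}) (B \<inter> {4..n}) (C \<inter> {4..n}))))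
    = (\<Sum>A\<in>Pow {4..n}. \<Sum>B\<in>Pow {4..n}. \<Sum>C\<in>Pow {4..n}.
        of_bool (int (card A) = int a - int (card K1)) * (of_bool (int (card B) = int b - int (card K2))
          * (of_bool (int (card C) = int c - int (card K3)) * h A B C)))"
proof -
  define H2 where "H2 A B = (\<Sum>C\<in>Pow {4..n}. of_bool (int (card C) = int c - int (card K3)) * h A B C)" for A B
  define H1 where "H1 A = (\<Sum>B\<in>Pow {4..n}. of_bool (int (card B) = int b - int (card K2)) * H2 A B)" for A
  have inner: "(\<Sum>C\<in>{R. R \<subseteq> {1..n} \<and> card R = c}. of_bool (C \<inter> {1..3} = K3) * h A B (C \<inter> {4..n})) = H2 A B" for A B
    unfolding H2_def by (rule sum_fixed_pattern[OF n K(3)])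
  have middle: "(\<Sum>B\<in>{R. R \<subseteq> {1..n} \<and> card R = b}. of_bool (B \<inter> {1..3} = K2) * H2 A (B \<inter> {4..n})) = H1 A" for A
    unfolding H1_def by (rule sum_fixed_pattern[OF n K(2)])
  have outer: "(\<Sum>A\<in>{R. R \<subseteq> {1..n} \<and> card R = a}. of_bool (A \<inter> {1..3} = K1) * H1 (A \<inter> {4..n}))
      = (\<Sum>A\<in>Pow {4..n}. of_bool (int (card A) = int a - int (card K1)) * H1 A)"
    by (rule sum_fixed_pattern[OF n K(1)])
  show ?thesis
    unfolding sum_distrib_left[symmetric] inner middle outer unfolding H1_def H2_def ..
qed

lemma chain_count_eq_sum:
  "chain_count I p q r = (\<Sum>A\<in>Pow I. \<Sum>B\<in>Pow I. \<Sum>C\<in>Pow I. of_bool (int (card A) = p)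
     * (of_bool (int (card B) = q) * (of_bool (int (card C) = r) * of_bool (dominated A B \<and> dominated B C))))"
  unfolding chain_count_def by (simp only: of_bool_conj mult.assoc)

text \<open>The empty set is dominated by every set, so the count of pairs is a value of the same
  determinant.\<close>

lemma chain_count_0:
  assumes "finite I"
  shows "chain_count I 0 q r = (\<Sum>B\<in>Pow I. \<Sum>C\<in>Pow I.
     of_bool (int (card B) = q) * (of_bool (int (card C) = r) * of_bool (dominated B C)))"
proof -
  have dom: "dominated {} B" for B by (simp add: dominated_def)
  have "chain_count I 0 q r = (\<Sum>A\<in>Pow I. of_bool (A = {}) * (\<Sum>B\<in>Pow I. \<Sum>C\<in>Pow I.
     of_bool (int (card B) = q) * (of_bool (int (card C) = r) * of_bool (dominated A B \<and> dominated B C))))"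
    unfolding chain_count_eq_sum sum_distrib_left[symmetric]
  proof (intro sum.cong refl arg_cong2[where f = "(*)"] arg_cong[where f = of_bool])
    fix A assume "A \<in> Pow I"
    then have "finite A" using assms finite_subset by blast
    then show "int (card A) = 0 \<longleftrightarrow> A = {}" by simp
  qed
  also have "\<dots> = (\<Sum>A\<in>{A\<in>Pow I. A = {}}. \<Sum>B\<in>Pow I. \<Sum>C\<in>Pow I.
     of_bool (int (card B) = q) * (of_bool (int (card C) = r) * of_bool (dominated A B \<and> dominated B C)))"
    using assms by (intro sum_of_bool_mult_filter) simp
  also have "{A\<in>Pow I. A = {}} = {{}}" by auto
  finally show ?thesis using dom by simp
qed

text \<open>\<open>B\<close> spends one particle and \<open>C\<close> two on the first three sites,
  whence the shifts by 1 and 2. The main term does not mention \<open>A\<close>, which gives the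
  factor \<open>n choose a\<close>; the negated condition of the event is subtracted.\<close>

lemma count_decreasing_event:
  assumes n: "n \<ge> 3" and le: "a \<le> b" "b \<le> c" "c \<le> n"
  defines "\<D> \<equiv> \<lambda>r. {R. R \<subseteq> {1..n} \<and> card R = r}"
  shows "(\<Sum>A\<in>\<D> a. \<Sum>B\<in>\<D> b. \<Sum>C\<in>\<D> c. of_bool (1 \<notin> C \<and> 2 \<in> C \<and> 2 \<notin> departures n B C
        \<and> 3 \<in> departures n (departures n A B) C))
    = real (n choose a) * binom_det (n - 3) 0 (int b - 1) (int c - 2)
      - binom_det (n - 3) (int a) (int b - 1) (int c - 2)"
proof -
  let ?I = "{4..n}"
  have I: "?I = {n - (n - 3)<..n}" using n by auto
  have K: "{} \<subseteq> {1..3 :: nat}" "{3} \<subseteq> {1..3 :: nat}" "{2, 3} \<subseteq> {1..3 :: nat}" by auto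
  have cardK: "int b - int (card {3 :: nat}) = int b - 1" "int c - int (card {2, 3 :: nat}) = int c - 2"
    "int a - int (card ({} :: nat set)) = int a" by simp_all
  let ?pat = "\<lambda>R K. of_bool (R \<inter> {1..3} = K) :: real"
  let ?main = "\<lambda>B C. ?pat B {3} * (?pat C {2, 3} * of_bool (dominated (B \<inter> ?I) (C \<inter> ?I)))"
  let ?bad = "\<lambda>A B C. ?pat A {} * (?pat B {3} * (?pat C {2, 3}
    * of_bool (dominated (A \<inter> ?I) (B \<inter> ?I) \<and> dominated (B \<inter> ?I) (C \<inter> ?I))))"
  have "(\<Sum>A\<in>\<D> a. \<Sum>B\<in>\<D> b. \<Sum>C\<in>\<D> c. of_bool (1 \<notin> C \<and> 2 \<in> C \<and> 2 \<notin> departures n B C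
        \<and> 3 \<in> departures n (departures n A B) C))
    = (\<Sum>A\<in>\<D> a. \<Sum>B\<in>\<D> b. \<Sum>C\<in>\<D> c. ?main B C - ?bad A B C)"
  proof (intro sum.cong refl)
    fix A B C assume "A \<in> \<D> a" "B \<in> \<D> b" "C \<in> \<D> c"
    then have "A \<subseteq> {1..n}" "B \<subseteq> {1..n}" "C \<subseteq> {1..n}" "card A \<le> card B" "card B \<le> card C"
      using le by (auto simp: \<D>_def)
    note iff = decreasing_event_iff[OF n this]
    show "of_bool (1 \<notin> C \<and> 2 \<in> C \<and> 2 \<notin> departures n B C
        \<and> 3 \<in> departures n (departures n A B) C) = ?main B C - ?bad A B C"
      unfolding iff by (simp add: of_bool_def)
  qed
  also have "\<dots> = real (card (\<D> a)) * (\<Sum>B\<in>\<D> b. \<Sum>C\<in>\<D> c. ?main B C)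
      - (\<Sum>A\<in>\<D> a. \<Sum>B\<in>\<D> b. \<Sum>C\<in>\<D> c. ?bad A B C)"
    unfolding sum_subtractf sum_constant ..
  also have "card (\<D> a) = n choose a" using n_subsets[of "{1..n}" a] by (simp add: \<D>_def)
  also have "(\<Sum>A\<in>\<D> a. \<Sum>B\<in>\<D> b. \<Sum>C\<in>\<D> c. ?bad A B C) = chain_count ?I (int a) (int b - 1) (int c - 2)"
    using sum_fixed_patterns[OF n K, where h = "\<lambda>A B C. of_bool (dominated A B \<and> dominated B C)"
        and a = a and b = b and c = c]
    unfolding \<D>_def chain_count_eq_sum cardK .
  also have "(\<Sum>B\<in>\<D> b. \<Sum>C\<in>\<D> c. ?main B C) = chain_count ?I 0 (int b - 1) (int c - 2)"
  proof -
    define H :: "nat set \<Rightarrow> real"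
      where "H B = (\<Sum>C\<in>Pow ?I. of_bool (int (card C) = int c - 2) * of_bool (dominated B C))" for B
    have "(\<Sum>C\<in>\<D> c. ?pat C {2, 3} * of_bool (dominated B (C \<inter> ?I))) = H B" for B
      unfolding \<D>_def H_def cardK(2)[symmetric] by (rule sum_fixed_pattern[OF n K(3)])
    moreover have "(\<Sum>B\<in>\<D> b. ?pat B {3} * H (B \<inter> ?I)) = (\<Sum>B\<in>Pow ?I. of_bool (int (card B) = int b - 1) * H B)"
      unfolding \<D>_def cardK(1)[symmetric] by (rule sum_fixed_pattern[OF n K(2)])
    ultimately show ?thesis
      unfolding chain_count_0[OF finite_atLeastAtMost] sum_distrib_left[symmetric] H_def by simp
  qed
  also have "chain_count ?I (int a) (int b - 1) (int c - 2) = binom_det (n - 3) (int a) (int b - 1) (int c - 2)"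
    unfolding I using n le by (intro chain_count_eq_binom_det) auto
  also have "chain_count ?I 0 (int b - 1) (int c - 2) = binom_det (n - 3) 0 (int b - 1) (int c - 2)"
    unfolding I using n le by (intro chain_count_eq_binom_det) auto
  finally show ?thesis .
qed

lemma prob_decreasing_thresholds:
  assumes st: "tasep_stationary n p" and n: "n \<ge> 3" and le: "a \<le> b" "b \<le> c" "c \<le> n"
  shows "(\<Sum>w\<in>tasep_states n. pmf p w * of_bool (c < w 1 \<and> b < w 2 \<and> w 2 \<le> c \<and> w 3 \<le> a))
    = (real n - b) * (real n - c) * (real c - b)
        * (real n * b * c - (real n - a) * (real c - a) * (real b - a))
      / (real n ^ 3 * (real n - 1) ^ 2 * (real n - 2))"
proof -
  let ?D = "\<lambda>r. {R. R \<subseteq> {1..n} \<and> card R = r}"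
  \<comment> \<open>Rows are added one at a time to the system without any sets, which is trivially
    invariant.\<close>
  define \<Omega> where "\<Omega> = (({()} \<times> ?D a) \<times> ?D b) \<times> ?D c"
  define Y where "Y = (\<lambda>(\<omega>, C). serve n ((\<lambda>(\<omega>, B). serve n ((\<lambda>(\<omega> :: unit, A). serve n [] A) \<omega>) B) \<omega>) C)"
  have Y: "Y ((((), A), B), C) = [departures n (departures n A B) C, departures n B C, C]" for A B C
    by (simp add: Y_def serve_def)
  have dep: "departures n S D \<subseteq> {1..n}" if "D \<subseteq> {1..n}" for S D
    using departures_subset that by blast
  have ring: "ring_stationary n \<Omega> Y"
    unfolding \<Omega>_def Y_def
    by (intro ring_stationary_serve) (use n dep in \<open>auto simp: serve_def ring_stationary_def\<close>)
  have fin: "finite (?D r)" for r by (rule finite_subset[of _ "Pow {1..n}"]) auto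
  have card: "card (?D r) = n choose r" for r using n_subsets[of "{1..n}" r] by simp
  have card_\<Omega>: "card \<Omega> = (n choose a) * (n choose b) * (n choose c)"
    unfolding \<Omega>_def card_cartesian_product card by simp
  have pos: "card \<Omega> > 0" unfolding card_\<Omega> using le by simp
  have \<Omega>: "finite \<Omega>" "\<Omega> \<noteq> {}" using pos card_gt_0_iff by blast+
  have lists: "Y \<omega> \<in> set_lists n [a, b, c]" if \<omega>: "\<omega> \<in> \<Omega>" for \<omega>
  proof -
    obtain A B C where e: "\<omega> = ((((), A), B), C)" and R: "A \<in> ?D a" "B \<in> ?D b" "C \<in> ?D c"
      using \<omega> unfolding \<Omega>_def by blast
    have sub: "A \<subseteq> {1..n}" "B \<subseteq> {1..n}" "C \<subseteq> {1..n}" and c: "card A = a" "card B = b" "card C = c"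
      using R by auto
    have n1: "n \<ge> 1" using n by simp
    have AB: "card (departures n A B) = a" using card_departures[OF n1 sub(1,2)] c le by simp
    have "card (departures n (departures n A B) C) = a" "card (departures n B C) = b"
      using card_departures[OF n1 dep[OF sub(2)] sub(3), of A] card_departures[OF n1 sub(2,3)] AB c le by simp_all
    then show ?thesis using dep[OF sub(3)] sub(3) c(3) unfolding e Y set_lists_def by simp
  qed
  let ?f = "\<lambda>L. of_bool (1 \<notin> L ! 2 \<and> 2 \<in> L ! 2 \<and> 2 \<notin> L ! 1 \<and> 3 \<in> L ! 0) :: real"
  have "(\<Sum>w\<in>tasep_states n. pmf p w * of_bool (c < w 1 \<and> b < w 2 \<and> w 2 \<le> c \<and> w 3 \<le> a))
      = (\<Sum>w\<in>tasep_states n. pmf p w * ?f (thresholds n [a, b, c] w))"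
  proof (intro sum.cong refl arg_cong2[where f = "(*)"] arg_cong[where f = of_bool])
    fix w
    show "(c < w 1 \<and> b < w 2 \<and> w 2 \<le> c \<and> w 3 \<le> a) \<longleftrightarrow>
      1 \<notin> thresholds n [a, b, c] w ! 2 \<and> 2 \<in> thresholds n [a, b, c] w ! 2 \<and>
      2 \<notin> thresholds n [a, b, c] w ! 1 \<and> 3 \<in> thresholds n [a, b, c] w ! 0"
      using n by (auto simp: thresholds_def not_le)
  qed
  also have "\<dots> = (\<Sum>\<omega>\<in>\<Omega>. ?f (Y \<omega>)) / card \<Omega>"
    using le by (intro stationary_thresholds_eq[OF st _ \<Omega> ring lists]) auto
  also have "(\<Sum>\<omega>\<in>\<Omega>. ?f (Y \<omega>)) = (\<Sum>A\<in>?D a. \<Sum>B\<in>?D b. \<Sum>C\<in>?D c. ?f (Y ((((), A), B), C)))"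
    unfolding \<Omega>_def sum.cartesian_product' by simp
  also have "\<dots> = real (n choose a) * binom_det (n - 3) 0 (int b - 1) (int c - 2)
      - binom_det (n - 3) (int a) (int b - 1) (int c - 2)"
    unfolding count_decreasing_event[OF n le, symmetric] Y by simp
  finally show ?thesis
    unfolding card_\<Omega> of_nat_mult using binom_det_ratio[OF n, of a b c] le by simp
qed

theorem theorem7p1:
  fixes n i j k :: nat and p :: "(nat \<Rightarrow> nat) pmf"
  assumes "n \<ge> 3"
    and "tasep_stationary n p"
    and "1 \<le> i" and "i < j" and "j < k" and "k \<le> n"
  shows "measure_pmf.prob p {w. w 1 = k \<and> w 2 = j \<and> w 3 = i} =
    6 * (real j - real i) * (real k - real i) * (real k - real j) /
      (real n ^ 3 * (real n - 1) ^ 2 * (real n - 2))"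
proof -
  let ?S = "tasep_states n" and ?E = "{w. w 1 = k \<and> w 2 = j \<and> w 3 = i}"
  define Q where "Q a b c = (\<Sum>w\<in>?S. pmf p w * of_bool (c < w 1 \<and> b < w 2 \<and> w 2 \<le> c \<and> w 3 \<le> a))" for a b c
  define Z where "Z = real n ^ 3 * (real n - 1) ^ 2 * (real n - 2)"
  define P where "P a b c = (real n - b) * (real n - c) * (c - b)
        * (real n * b * c - (real n - a) * (c - a) * (b - a))" for a b c :: real
  \<comment> \<open>All eight corners used below satisfy \<open>a \<le> b \<le> c \<le> n\<close>
    because \<open>i < j < k \<le> n\<close>.\<close>
  have Q: "Q a b c = P a b c / Z" if "a \<le> b" "b \<le> c" "c \<le> n" for a b c
    unfolding Q_def P_def Z_def by (rule prob_decreasing_thresholds) (use assms that in auto)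
  have supp: "set_pmf p \<subseteq> ?S" using assms(2) by (simp add: tasep_stationary_def)
  have "?E \<inter> set_pmf p = (?E \<inter> ?S) \<inter> set_pmf p" using supp by blast
  then have "measure_pmf.prob p ?E = measure_pmf.prob p (?E \<inter> ?S)"
    using measure_Int_set_pmf[of p ?E] measure_Int_set_pmf[of p "?E \<inter> ?S"] by simp
  also have "\<dots> = (\<Sum>w\<in>?E \<inter> ?S. pmf p w)"
    using finite_tasep_states by (intro measure_measure_pmf_finite) simp
  also have "\<dots> = (\<Sum>w\<in>?S. pmf p w * of_bool (w 1 = k \<and> w 2 = j \<and> w 3 = i))"
    using sum_of_bool_mult_filter[OF finite_tasep_states, of "\<lambda>w. w \<in> ?E" "pmf p" n]
    by (simp add: mult.commute Int_def conj_commute)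
  \<comment> \<open>The difference in \<open>c\<close> gives the event \<open>w 1 = k\<close>,
    \<open>w 2 < k\<close> minus the event \<open>w 1 > k\<close>, \<open>w 2 = k\<close>. As
    \<open>j < k\<close>, the latter is the same for \<open>b = j - 1\<close> and
    \<open>b = j\<close>, so the difference in \<open>b\<close> removes it.\<close>
  also have "\<dots> = (Q i (j - 1) (k - 1) - Q (i - 1) (j - 1) (k - 1) - (Q i j (k - 1) - Q (i - 1) j (k - 1)))
      - (Q i (j - 1) k - Q (i - 1) (j - 1) k - (Q i j k - Q (i - 1) j k))"
    unfolding Q_def sum_subtractf[symmetric] right_diff_distrib[symmetric]
  proof (intro sum.cong refl arg_cong2[where f = "(*)"])
    fix w :: "nat \<Rightarrow> nat"
    have a: "w 3 \<le> i - 1 \<longleftrightarrow> w 3 < i" "j - 1 < w 2 \<longleftrightarrow> j \<le> w 2" "k - 1 < w 1 \<longleftrightarrow> k \<le> w 1" "w 2 \<le> k - 1 \<longleftrightarrow> w 2 < k"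
      using assms by auto
    show "of_bool (w 1 = k \<and> w 2 = j \<and> w 3 = i)
      = of_bool (k - 1 < w 1 \<and> j - 1 < w 2 \<and> w 2 \<le> k - 1 \<and> w 3 \<le> i)
        - of_bool (k - 1 < w 1 \<and> j - 1 < w 2 \<and> w 2 \<le> k - 1 \<and> w 3 \<le> i - 1)
        - (of_bool (k - 1 < w 1 \<and> j < w 2 \<and> w 2 \<le> k - 1 \<and> w 3 \<le> i)
          - of_bool (k - 1 < w 1 \<and> j < w 2 \<and> w 2 \<le> k - 1 \<and> w 3 \<le> i - 1))
        - (of_bool (k < w 1 \<and> j - 1 < w 2 \<and> w 2 \<le> k \<and> w 3 \<le> i)
          - of_bool (k < w 1 \<and> j - 1 < w 2 \<and> w 2 \<le> k \<and> w 3 \<le> i - 1)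
          - (of_bool (k < w 1 \<and> j < w 2 \<and> w 2 \<le> k \<and> w 3 \<le> i)
            - (of_bool (k < w 1 \<and> j < w 2 \<and> w 2 \<le> k \<and> w 3 \<le> i - 1) :: real)))"
      unfolding a using \<open>j < k\<close> by (auto simp: of_bool_def)
  qed
  also have "\<dots> = ((P i (real j - 1) (real k - 1) - P (real i - 1) (real j - 1) (real k - 1)
        - (P i j (real k - 1) - P (real i - 1) j (real k - 1)))
      - (P i (real j - 1) k - P (real i - 1) (real j - 1) k - (P i j k - P (real i - 1) j k))) / Z"
    using assms by (simp add: Q of_nat_diff diff_divide_distrib)
  \<comment> \<open>\<open>P\<close> is a term free of \<open>a\<close>, which the difference in
    \<open>a\<close> kills, minus the Vandermonde product of \<open>a\<close>, \<open>b\<close>,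
    \<open>c\<close>, \<open>n\<close>. In its determinant the differences turn the rows
    \<open>(1, x, x^2, x^3)\<close> of \<open>a\<close>, \<open>b\<close>, \<open>c\<close> into
    \<open>(0, 1, 2x - 1, 3x^2 - 3x + 1)\<close>, so the leading coefficients 1, 2, 3 give the
    factor 6 and \<open>n\<close> drops out.\<close>
  also have "\<dots> = 6 * (real j - real i) * (real k - real i) * (real k - real j) / Z"
    unfolding P_def by (rule arg_cong[where f = "\<lambda>x. x / Z"]) algebra
  finally show ?thesis unfolding Z_def .
qed

end
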